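(* The theory $\mathrm{RKf}$ of finitely additive typefree probability can be interpreted in the standard model of arithmetic, i.e. there is an interpretation of $\Pr$ over the standard structure of numbers (with standard natural numbers) under which all theorems of $\mathrm{RKf}$ are true. Hence $\mathrm{RKf}$ is $\omega$-consistent.
   Context: All theories are in classical first-order logic. $Q^-$ is a standard classical theory of the rational numbers, true in the standard structure of the rationals (codable in the standard model of arithmetic), in a language $\mathcal{L}_{Q^-}$ having a predicate $N$ for being a natural number, such that $Q^-$ contains the Peano axioms restricted to $N$ (so syntax can be coded). $\mathcal{L}_Q=\mathcal{L}_{Q^-}\cup\{\Pr\}$, where $\Pr$ is a two-place predicate; $\Pr(x,y)$, also written $\Pr(x)=y$, says that the subjective probability of (the sentence coded by) $x$ is $y$. $Q$ is $Q^-$ with all its logical and nonlogical schemes (including induction) extended to $\mathcal{L}_Q$. $\mathrm{Tm}^c$ is the set of constant terms, $t^\circ$ the value of the term $t$; dotted connectives are the syntactic operations on codes; distinctions between sentences and their codes are suppressed. $\mathrm{RKf}$ has the following axioms and rule (free variables universally quantified, $x,y$ ranging over codes of sentences of $\mathcal{L}_Q$ where they are arguments of $\Pr$, and $\Pr(x)$ being used as a term for the unique value): 1. all axioms of $Q$; 2. $\Pr$ is a function; 3. $\Pr(x,y)\rightarrow (x$ is a sentence of $\mathcal{L}_Q\ \wedge\ 0\le y\le 1)$; 4. $\forall t\in \mathrm{Tm}^c\,(\Pr(\varphi(t))=1\leftrightarrow \varphi(t^\circ))$, for every formula $\varphi$ of $\mathcal{L}_{Q^-}$; 5. $\Pr(x)\le\Pr(x\dot\vee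 y)$ and $\Pr(y)\le \Pr(x\dot\vee y)$; 6. $\Pr(x\dot\vee y)=\Pr(x)+\Pr(y)-\Pr(x\dot\wedge y)$; 7. $\Pr(\dot\neg x)=1-\Pr(x)$; 8. (Necessitation rule) from $\vdash\varphi$ infer $\vdash\Pr(\varphi,1)$. A theory is $\omega$-consistent if there is no formula $\varphi(x)$ such that it proves $\varphi(\underline n)$ for every natural number $n$ and also proves $\exists x\,(N(x)\wedge\neg\varphi(x))$. *)

theory Defs
  imports Complex_Main "HOL-Library.Nat_Bijection"
begin

section \<open>Syntax\<close>

text \<open>
  Formulas of \<open>\<L>\<^sub>Q\<close> with de Bruijn indices. The language \<open>\<L>\<close> of \<open>Q\<^sup>-\<close> is that of ordered
  fields (division total, with \<open>x / 0 = 0\<close>) plus the predicate \<open>N\<close>, so that every rational is the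
  value of a constant term. A formula of \<open>\<L>\<close> is a formula without \<open>Pr\<close>.
\<close>

datatype tm =
    Var nat
  | Zero (\<open>\<^bold>0\<close>)
  | One (\<open>\<^bold>1\<close>)
  | Add tm tm (infixl \<open>\<^bold>+\<close> 75)
  | Sub tm tm (infixl \<open>\<^bold>-\<close> 75)
  | Mul tm tm (infixl \<open>\<^bold>*\<close> 80)
  | Div tm tm (infixl \<open>\<^bold>'/\<close> 80)

datatype fm =
    Eq tm tm (infix \<open>\<^bold>=\<close> 70)
  | Le tm tm (infix \<open>\<^bold>\<le>\<close> 70)
  | N tm
  | Pr tm tm
  | Neg fm (\<open>\<^bold>\<not> _\<close> [68] 68)
  | Con fm fm (infixr \<open>\<^bold>\<and>\<close> 66)
  | Dis fm fm (infixr \<open>\<^bold>\<or>\<close> 65)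
  | All fm (\<open>\<^bold>\<forall> _\<close> [68] 68)

abbreviation Imp :: "fm \<Rightarrow> fm \<Rightarrow> fm" (infixr \<open>\<^bold>\<longrightarrow>\<close> 64)
  where "\<phi> \<^bold>\<longrightarrow> \<psi> \<equiv> \<^bold>\<not> \<phi> \<^bold>\<or> \<psi>"

abbreviation Iff :: "fm \<Rightarrow> fm \<Rightarrow> fm" (infix \<open>\<^bold>\<longleftrightarrow>\<close> 63)
  where "\<phi> \<^bold>\<longleftrightarrow> \<psi> \<equiv> (\<phi> \<^bold>\<longrightarrow> \<psi>) \<^bold>\<and> (\<psi> \<^bold>\<longrightarrow> \<phi>)"

abbreviation Ex :: "fm \<Rightarrow> fm" (\<open>\<^bold>\<exists> _\<close> [68] 68)
  where "\<^bold>\<exists> \<phi> \<equiv> \<^bold>\<not> \<^bold>\<forall> \<^bold>\<not> \<phi>"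

abbreviation AllN :: "fm \<Rightarrow> fm" (\<open>\<^bold>\<forall>\<^sub>N _\<close> [68] 68)
  where "\<^bold>\<forall>\<^sub>N \<phi> \<equiv> \<^bold>\<forall> (N (Var 0) \<^bold>\<longrightarrow> \<phi>)"

abbreviation ExN :: "fm \<Rightarrow> fm" (\<open>\<^bold>\<exists>\<^sub>N _\<close> [68] 68)
  where "\<^bold>\<exists>\<^sub>N \<phi> \<equiv> \<^bold>\<exists> (N (Var 0) \<^bold>\<and> \<phi>)"

abbreviation Less :: "tm \<Rightarrow> tm \<Rightarrow> fm" (infix \<open>\<^bold><\<close> 70)
  where "s \<^bold>< t \<equiv> s \<^bold>\<le> t \<^bold>\<and> \<^bold>\<not> s \<^bold>= t"

primrec pr_free :: "fm \<Rightarrow> bool" where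
  "pr_free (s \<^bold>= t) \<longleftrightarrow> True"
| "pr_free (s \<^bold>\<le> t) \<longleftrightarrow> True"
| "pr_free (N t) \<longleftrightarrow> True"
| "pr_free (Pr s t) \<longleftrightarrow> False"
| "pr_free (\<^bold>\<not> \<phi>) \<longleftrightarrow> pr_free \<phi>"
| "pr_free (\<phi> \<^bold>\<and> \<psi>) \<longleftrightarrow> pr_free \<phi> \<and> pr_free \<psi>"
| "pr_free (\<phi> \<^bold>\<or> \<psi>) \<longleftrightarrow> pr_free \<phi> \<and> pr_free \<psi>"
| "pr_free (\<^bold>\<forall> \<phi>) \<longleftrightarrow> pr_free \<phi>"

primrec tm_below :: "nat \<Rightarrow> tm \<Rightarrow> bool" where
  "tm_below n (Var i) \<longleftrightarrow> i < n"
| "tm_below n \<^bold>0 \<longleftrightarrow> True"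
| "tm_below n \<^bold>1 \<longleftrightarrow> True"
| "tm_below n (s \<^bold>+ t) \<longleftrightarrow> tm_below n s \<and> tm_below n t"
| "tm_below n (s \<^bold>- t) \<longleftrightarrow> tm_below n s \<and> tm_below n t"
| "tm_below n (s \<^bold>* t) \<longleftrightarrow> tm_below n s \<and> tm_below n t"
| "tm_below n (s \<^bold>/ t) \<longleftrightarrow> tm_below n s \<and> tm_below n t"

text \<open>\<open>fm_below n \<phi>\<close>: the free variables of \<open>\<phi>\<close> are among \<open>Var 0, \<dots>, Var (n - 1)\<close>.\<close>

primrec fm_below :: "nat \<Rightarrow> fm \<Rightarrow> bool" where
  "fm_below n (s \<^bold>= t) \<longleftrightarrow> tm_below n s \<and> tm_below n t"
| "fm_below n (s \<^bold>\<le> t) \<longleftrightarrow> tm_below n s \<and> tm_below n t"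
| "fm_below n (N t) \<longleftrightarrow> tm_below n t"
| "fm_below n (Pr s t) \<longleftrightarrow> tm_below n s \<and> tm_below n t"
| "fm_below n (\<^bold>\<not> \<phi>) \<longleftrightarrow> fm_below n \<phi>"
| "fm_below n (\<phi> \<^bold>\<and> \<psi>) \<longleftrightarrow> fm_below n \<phi> \<and> fm_below n \<psi>"
| "fm_below n (\<phi> \<^bold>\<or> \<psi>) \<longleftrightarrow> fm_below n \<phi> \<and> fm_below n \<psi>"
| "fm_below n (\<^bold>\<forall> \<phi>) \<longleftrightarrow> fm_below (Suc n) \<phi>"

abbreviation sentence :: "fm \<Rightarrow> bool"
  where "sentence \<equiv> fm_below 0"

primrec subst_tm :: "(nat \<Rightarrow> tm) \<Rightarrow> tm \<Rightarrow> tm" where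
  "subst_tm \<sigma> (Var i) = \<sigma> i"
| "subst_tm \<sigma> \<^bold>0 = \<^bold>0"
| "subst_tm \<sigma> \<^bold>1 = \<^bold>1"
| "subst_tm \<sigma> (s \<^bold>+ t) = subst_tm \<sigma> s \<^bold>+ subst_tm \<sigma> t"
| "subst_tm \<sigma> (s \<^bold>- t) = subst_tm \<sigma> s \<^bold>- subst_tm \<sigma> t"
| "subst_tm \<sigma> (s \<^bold>* t) = subst_tm \<sigma> s \<^bold>* subst_tm \<sigma> t"
| "subst_tm \<sigma> (s \<^bold>/ t) = subst_tm \<sigma> s \<^bold>/ subst_tm \<sigma> t"

definition shift :: "nat \<Rightarrow> tm \<Rightarrow> tm"
  where "shift k = subst_tm (\<lambda>i. Var (i + k))"

primrec subst :: "(nat \<Rightarrow> tm) \<Rightarrow> fm \<Rightarrow> fm" where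
  "subst \<sigma> (s \<^bold>= t) = (subst_tm \<sigma> s \<^bold>= subst_tm \<sigma> t)"
| "subst \<sigma> (s \<^bold>\<le> t) = (subst_tm \<sigma> s \<^bold>\<le> subst_tm \<sigma> t)"
| "subst \<sigma> (N t) = N (subst_tm \<sigma> t)"
| "subst \<sigma> (Pr s t) = Pr (subst_tm \<sigma> s) (subst_tm \<sigma> t)"
| "subst \<sigma> (\<^bold>\<not> \<phi>) = \<^bold>\<not> subst \<sigma> \<phi>"
| "subst \<sigma> (\<phi> \<^bold>\<and> \<psi>) = subst \<sigma> \<phi> \<^bold>\<and> subst \<sigma> \<psi>"
| "subst \<sigma> (\<phi> \<^bold>\<or> \<psi>) = subst \<sigma> \<phi> \<^bold>\<or> subst \<sigma> \<psi>"
| "subst \<sigma> (\<^bold>\<forall> \<phi>) = \<^bold>\<forall> subst (case_nat (Var 0) (\<lambda>i. shift 1 (\<sigma> i))) \<phi>"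

definition lift :: "fm \<Rightarrow> fm"
  where "lift = subst (\<lambda>i. Var (Suc i))"

text \<open>\<open>inst \<phi> t\<close> replaces \<open>Var 0\<close> by \<open>t\<close> and lowers the remaining free variables.\<close>

definition inst :: "fm \<Rightarrow> tm \<Rightarrow> fm"
  where "inst \<phi> t = subst (case_nat t Var) \<phi>"

primrec num :: "nat \<Rightarrow> tm" where
  "num 0 = \<^bold>0"
| "num (Suc n) = num n \<^bold>+ \<^bold>1"


section \<open>The standard structure\<close>

primrec eval :: "(nat \<Rightarrow> rat) \<Rightarrow> tm \<Rightarrow> rat" where
  "eval e (Var i) = e i"
| "eval e \<^bold>0 = 0"
| "eval e \<^bold>1 = 1"
| "eval e (s \<^bold>+ t) = eval e s + eval e t"
| "eval e (s \<^bold>- t) = eval e s - eval e t"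
| "eval e (s \<^bold>* t) = eval e s * eval e t"
| "eval e (s \<^bold>/ t) = eval e s / eval e t"

text \<open>Satisfaction in the expansion of the standard rationals that interprets \<open>Pr\<close> by \<open>P\<close>.\<close>

primrec sat :: "(rat \<Rightarrow> rat \<Rightarrow> bool) \<Rightarrow> (nat \<Rightarrow> rat) \<Rightarrow> fm \<Rightarrow> bool" where
  "sat P e (s \<^bold>= t) \<longleftrightarrow> eval e s = eval e t"
| "sat P e (s \<^bold>\<le> t) \<longleftrightarrow> eval e s \<le> eval e t"
| "sat P e (N t) \<longleftrightarrow> eval e t \<in> \<nat>"
| "sat P e (Pr s t) \<longleftrightarrow> P (eval e s) (eval e t)"
| "sat P e (\<^bold>\<not> \<phi>) \<longleftrightarrow> \<not> sat P e \<phi>"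
| "sat P e (\<phi> \<^bold>\<and> \<psi>) \<longleftrightarrow> sat P e \<phi> \<and> sat P e \<psi>"
| "sat P e (\<phi> \<^bold>\<or> \<psi>) \<longleftrightarrow> sat P e \<phi> \<or> sat P e \<psi>"
| "sat P e (\<^bold>\<forall> \<phi>) \<longleftrightarrow> (\<forall>a. sat P (case_nat a e) \<phi>)"

definition true_in :: "(rat \<Rightarrow> rat \<Rightarrow> bool) \<Rightarrow> fm \<Rightarrow> bool"
  where "true_in P \<phi> \<longleftrightarrow> (\<forall>e. sat P e \<phi>)"


section \<open>Codes\<close>

primrec code_tm :: "tm \<Rightarrow> nat" where
  "code_tm (Var i) = prod_encode (0, i)"
| "code_tm \<^bold>0 = prod_encode (1, 0)"
| "code_tm \<^bold>1 = prod_encode (2, 0)"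
| "code_tm (s \<^bold>+ t) = prod_encode (3, prod_encode (code_tm s, code_tm t))"
| "code_tm (s \<^bold>- t) = prod_encode (4, prod_encode (code_tm s, code_tm t))"
| "code_tm (s \<^bold>* t) = prod_encode (5, prod_encode (code_tm s, code_tm t))"
| "code_tm (s \<^bold>/ t) = prod_encode (6, prod_encode (code_tm s, code_tm t))"

primrec code :: "fm \<Rightarrow> nat" where
  "code (s \<^bold>= t) = prod_encode (7, prod_encode (code_tm s, code_tm t))"
| "code (s \<^bold>\<le> t) = prod_encode (8, prod_encode (code_tm s, code_tm t))"
| "code (N t) = prod_encode (9, code_tm t)"
| "code (Pr s t) = prod_encode (10, prod_encode (code_tm s, code_tm t))"
| "code (\<^bold>\<not> \<phi>) = prod_encode (11, code \<phi>)"
| "code (\<phi> \<^bold>\<and> \<psi>) = prod_encode (12, prod_encode (code \<phi>, code \<psi>))"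
| "code (\<phi> \<^bold>\<or> \<psi>) = prod_encode (13, prod_encode (code \<phi>, code \<psi>))"
| "code (\<^bold>\<forall> \<phi>) = prod_encode (14, code \<phi>)"


section \<open>Arithmetized syntax\<close>

text \<open>The pairing function is a polynomial with rational coefficients, hence given by a term.\<close>

definition pair :: "tm \<Rightarrow> tm \<Rightarrow> tm"
  where "pair s t = (s \<^bold>+ t) \<^bold>* (s \<^bold>+ t \<^bold>+ \<^bold>1) \<^bold>/ num 2 \<^bold>+ s"

abbreviation node :: "nat \<Rightarrow> tm \<Rightarrow> tm \<Rightarrow> tm"
  where "node k s t \<equiv> pair (num k) (pair s t)"

abbreviation neg_code :: "tm \<Rightarrow> tm" where "neg_code x \<equiv> pair (num 11) x"
abbreviation con_code :: "tm \<Rightarrow> tm \<Rightarrow> tm" where "con_code x y \<equiv> node 12 x y"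
abbreviation dis_code :: "tm \<Rightarrow> tm \<Rightarrow> tm" where "dis_code x y \<equiv> node 13 x y"

text \<open>
  \<open>sub_code 0 c \<phi>\<close> is a term whose value is the code of \<open>inst \<phi> t\<close> whenever \<open>\<phi>\<close> has at most
  \<open>Var 0\<close> free and the value of \<open>c\<close> is the code of the constant term \<open>t\<close>. The first argument
  counts the quantifiers passed.
\<close>

primrec sub_code_tm :: "nat \<Rightarrow> tm \<Rightarrow> tm \<Rightarrow> tm" where
  "sub_code_tm k c (Var i) = (if i = k then c else num (code_tm (Var i)))"
| "sub_code_tm k c \<^bold>0 = num (code_tm \<^bold>0)"
| "sub_code_tm k c \<^bold>1 = num (code_tm \<^bold>1)"
| "sub_code_tm k c (s \<^bold>+ t) = node 3 (sub_code_tm k c s) (sub_code_tm k c t)"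
| "sub_code_tm k c (s \<^bold>- t) = node 4 (sub_code_tm k c s) (sub_code_tm k c t)"
| "sub_code_tm k c (s \<^bold>* t) = node 5 (sub_code_tm k c s) (sub_code_tm k c t)"
| "sub_code_tm k c (s \<^bold>/ t) = node 6 (sub_code_tm k c s) (sub_code_tm k c t)"

primrec sub_code :: "nat \<Rightarrow> tm \<Rightarrow> fm \<Rightarrow> tm" where
  "sub_code k c (s \<^bold>= t) = node 7 (sub_code_tm k c s) (sub_code_tm k c t)"
| "sub_code k c (s \<^bold>\<le> t) = node 8 (sub_code_tm k c s) (sub_code_tm k c t)"
| "sub_code k c (N t) = pair (num 9) (sub_code_tm k c t)"
| "sub_code k c (Pr s t) = node 10 (sub_code_tm k c s) (sub_code_tm k c t)"
| "sub_code k c (\<^bold>\<not> \<phi>) = neg_code (sub_code k c \<phi>)"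
| "sub_code k c (\<phi> \<^bold>\<and> \<psi>) = con_code (sub_code k c \<phi>) (sub_code k c \<psi>)"
| "sub_code k c (\<phi> \<^bold>\<or> \<psi>) = dis_code (sub_code k c \<phi>) (sub_code k c \<psi>)"
| "sub_code k c (\<^bold>\<forall> \<phi>) = pair (num 14) (sub_code (Suc k) c \<phi>)"

text \<open>
  Recursively defined syntactic notions are expressed by the existence of a finite set of codes in
  which each member is justified by smaller ones. The triple \<open>(b, m, d)\<close> of natural numbers
  stands for the finite set of all \<open>x \<le> b\<close> such that \<open>1 + (x + 1) m\<close> divides \<open>d\<close>; every finite
  set of natural numbers is of this form.
\<close>

definition Mem :: "tm \<Rightarrow> tm \<Rightarrow> tm \<Rightarrow> tm \<Rightarrow> fm" where
  "Mem x b m d = N x \<^bold>\<and> x \<^bold>\<le> b \<^bold>\<and>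
     \<^bold>\<exists>\<^sub>N (Var 0 \<^bold>* (\<^bold>1 \<^bold>+ (shift 1 x \<^bold>+ \<^bold>1) \<^bold>* shift 1 m) \<^bold>= shift 1 d)"

text \<open>\<open>Term x n\<close>: \<open>x\<close> codes a term whose variables are below \<open>n\<close>.\<close>

definition Term :: "tm \<Rightarrow> tm \<Rightarrow> fm" where
  "Term x n =
     \<^bold>\<exists>\<^sub>N \<^bold>\<exists>\<^sub>N \<^bold>\<exists>\<^sub>N \<comment> \<open>b = Var 2, m = Var 1, d = Var 0\<close>
       (Mem (shift 3 x) (Var 2) (Var 1) (Var 0) \<^bold>\<and>
        \<^bold>\<forall>\<^sub>N \<comment> \<open>y = Var 0\<close>
          (Mem (Var 0) (Var 3) (Var 2) (Var 1) \<^bold>\<longrightarrow>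
             \<^bold>\<exists>\<^sub>N (Var 0 \<^bold>< shift 5 n \<^bold>\<and> Var 1 \<^bold>= pair (num 0) (Var 0))
           \<^bold>\<or> Var 0 \<^bold>= num (code_tm \<^bold>0)
           \<^bold>\<or> Var 0 \<^bold>= num (code_tm \<^bold>1)
           \<^bold>\<or> \<^bold>\<exists>\<^sub>N \<^bold>\<exists>\<^sub>N \<comment> \<open>s = Var 1, t = Var 0, y = Var 2\<close>
               (Mem (Var 1) (Var 5) (Var 4) (Var 3) \<^bold>\<and>
                Mem (Var 0) (Var 5) (Var 4) (Var 3) \<^bold>\<and>
                (Var 2 \<^bold>= node 3 (Var 1) (Var 0)
               \<^bold>\<or> Var 2 \<^bold>= node 4 (Var 1) (Var 0)
               \<^bold>\<or> Var 2 \<^bold>= node 5 (Var 1) (Var 0)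
               \<^bold>\<or> Var 2 \<^bold>= node 6 (Var 1) (Var 0)))))"

text \<open>\<open>Form x n\<close>: \<open>x\<close> codes a formula whose free variables are below \<open>n\<close>.\<close>

definition Form :: "tm \<Rightarrow> tm \<Rightarrow> fm" where
  "Form x n = N x \<^bold>\<and> N n \<^bold>\<and>
     \<^bold>\<exists>\<^sub>N \<^bold>\<exists>\<^sub>N \<^bold>\<exists>\<^sub>N \<comment> \<open>b = Var 2, m = Var 1, d = Var 0\<close>
       (Mem (pair (shift 3 x) (shift 3 n)) (Var 2) (Var 1) (Var 0) \<^bold>\<and>
        \<^bold>\<forall>\<^sub>N \<^bold>\<forall>\<^sub>N \<comment> \<open>y = Var 1, k = Var 0\<close>
          (Mem (pair (Var 1) (Var 0)) (Var 4) (Var 3) (Var 2) \<^bold>\<longrightarrow>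
             \<^bold>\<exists>\<^sub>N \<^bold>\<exists>\<^sub>N \<comment> \<open>s = Var 1, t = Var 0, y = Var 3, k = Var 2\<close>
               (Term (Var 1) (Var 2) \<^bold>\<and> Term (Var 0) (Var 2) \<^bold>\<and>
                (Var 3 \<^bold>= node 7 (Var 1) (Var 0)
               \<^bold>\<or> Var 3 \<^bold>= node 8 (Var 1) (Var 0)
               \<^bold>\<or> Var 3 \<^bold>= pair (num 9) (Var 1)
               \<^bold>\<or> Var 3 \<^bold>= node 10 (Var 1) (Var 0)))
           \<^bold>\<or> \<^bold>\<exists>\<^sub>N \<^bold>\<exists>\<^sub>N \<comment> \<open>u = Var 1, v = Var 0, y = Var 3, k = Var 2\<close>
               (Mem (pair (Var 1) (Var 2)) (Var 6) (Var 5) (Var 4) \<^bold>\<and>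
                Mem (pair (Var 0) (Var 2)) (Var 6) (Var 5) (Var 4) \<^bold>\<and>
                (Var 3 \<^bold>= neg_code (Var 1)
               \<^bold>\<or> Var 3 \<^bold>= con_code (Var 1) (Var 0)
               \<^bold>\<or> Var 3 \<^bold>= dis_code (Var 1) (Var 0)))
           \<^bold>\<or> \<^bold>\<exists>\<^sub>N \<comment> \<open>u = Var 0, y = Var 2, k = Var 1\<close>
               (Mem (pair (Var 0) (Var 1 \<^bold>+ \<^bold>1)) (Var 5) (Var 4) (Var 3) \<^bold>\<and>
                Var 2 \<^bold>= pair (num 14) (Var 0))))"

definition Sent :: "tm \<Rightarrow> fm"
  where "Sent x = Form x \<^bold>0"

definition ConstTerm :: "tm \<Rightarrow> fm"
  where "ConstTerm x = Term x \<^bold>0"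

text \<open>
  The set codes natural numbers only, so a pair of a natural number \<open>x\<close> and a rational
  \<open>w = (p - q) / (r + 1)\<close> is entered in it as the number of \<open>(x, p, q, r)\<close>.
\<close>

definition MemQ :: "tm \<Rightarrow> tm \<Rightarrow> tm \<Rightarrow> tm \<Rightarrow> tm \<Rightarrow> fm" where
  "MemQ x w b m d =
     \<^bold>\<exists>\<^sub>N \<^bold>\<exists>\<^sub>N \<^bold>\<exists>\<^sub>N \<comment> \<open>p = Var 2, q = Var 1, r = Var 0\<close>
       (shift 3 w \<^bold>= (Var 2 \<^bold>- Var 1) \<^bold>/ (Var 0 \<^bold>+ \<^bold>1) \<^bold>\<and>
        Mem (pair (shift 3 x) (pair (Var 2) (pair (Var 1) (Var 0))))
          (shift 3 b) (shift 3 m) (shift 3 d))"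

text \<open>\<open>Val x w\<close>: \<open>x\<close> codes a constant term with value \<open>w\<close>.\<close>

definition Val :: "tm \<Rightarrow> tm \<Rightarrow> fm" where
  "Val x w = N x \<^bold>\<and>
     \<^bold>\<exists>\<^sub>N \<^bold>\<exists>\<^sub>N \<^bold>\<exists>\<^sub>N \<comment> \<open>b = Var 2, m = Var 1, d = Var 0\<close>
       (MemQ (shift 3 x) (shift 3 w) (Var 2) (Var 1) (Var 0) \<^bold>\<and>
        \<^bold>\<forall>\<^sub>N \<^bold>\<forall> \<comment> \<open>y = Var 1, z = Var 0\<close>
          (MemQ (Var 1) (Var 0) (Var 4) (Var 3) (Var 2) \<^bold>\<longrightarrow>
             Var 1 \<^bold>= num (code_tm \<^bold>0) \<^bold>\<and> Var 0 \<^bold>= \<^bold>0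
           \<^bold>\<or> Var 1 \<^bold>= num (code_tm \<^bold>1) \<^bold>\<and> Var 0 \<^bold>= \<^bold>1
           \<^bold>\<or> \<^bold>\<exists>\<^sub>N \<^bold>\<exists>\<^sub>N \<^bold>\<exists> \<^bold>\<exists> \<comment> \<open>s = Var 3, t = Var 2, s' = Var 1, t' = Var 0, y = Var 5, z = Var 4\<close>
               (MemQ (Var 3) (Var 1) (Var 8) (Var 7) (Var 6) \<^bold>\<and>
                MemQ (Var 2) (Var 0) (Var 8) (Var 7) (Var 6) \<^bold>\<and>
                (Var 5 \<^bold>= node 3 (Var 3) (Var 2) \<^bold>\<and> Var 4 \<^bold>= Var 1 \<^bold>+ Var 0
               \<^bold>\<or> Var 5 \<^bold>= node 4 (Var 3) (Var 2) \<^bold>\<and> Var 4 \<^bold>= Var 1 \<^bold>- Var 0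
               \<^bold>\<or> Var 5 \<^bold>= node 5 (Var 3) (Var 2) \<^bold>\<and> Var 4 \<^bold>= Var 1 \<^bold>* Var 0
               \<^bold>\<or> Var 5 \<^bold>= node 6 (Var 3) (Var 2) \<^bold>\<and> Var 4 \<^bold>= Var 1 \<^bold>/ Var 0))))"


section \<open>Classical logic with identity over \<open>\<L>\<^sub>Q\<close>\<close>

text \<open>Truth-functional evaluation: atomic and quantified formulas are treated as letters.\<close>

primrec prop_eval :: "(fm \<Rightarrow> bool) \<Rightarrow> fm \<Rightarrow> bool" where
  "prop_eval v (s \<^bold>= t) \<longleftrightarrow> v (s \<^bold>= t)"
| "prop_eval v (s \<^bold>\<le> t) \<longleftrightarrow> v (s \<^bold>\<le> t)"
| "prop_eval v (N t) \<longleftrightarrow> v (N t)"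
| "prop_eval v (Pr s t) \<longleftrightarrow> v (Pr s t)"
| "prop_eval v (\<^bold>\<not> \<phi>) \<longleftrightarrow> \<not> prop_eval v \<phi>"
| "prop_eval v (\<phi> \<^bold>\<and> \<psi>) \<longleftrightarrow> prop_eval v \<phi> \<and> prop_eval v \<psi>"
| "prop_eval v (\<phi> \<^bold>\<or> \<psi>) \<longleftrightarrow> prop_eval v \<phi> \<or> prop_eval v \<psi>"
| "prop_eval v (\<^bold>\<forall> \<phi>) \<longleftrightarrow> v (\<^bold>\<forall> \<phi>)"

inductive_set logical_axioms :: "fm set" where
  taut: "(\<And>v. prop_eval v \<phi>) \<Longrightarrow> \<phi> \<in> logical_axioms"
| all_inst: "(\<^bold>\<forall> \<phi> \<^bold>\<longrightarrow> inst \<phi> t) \<in> logical_axioms"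
| all_imp: "(\<^bold>\<forall> (\<phi> \<^bold>\<longrightarrow> \<psi>) \<^bold>\<longrightarrow> \<^bold>\<forall> \<phi> \<^bold>\<longrightarrow> \<^bold>\<forall> \<psi>) \<in> logical_axioms"
| all_vacuous: "(\<phi> \<^bold>\<longrightarrow> \<^bold>\<forall> (lift \<phi>)) \<in> logical_axioms"
| eq_refl: "(t \<^bold>= t) \<in> logical_axioms"
| eq_subst: "(s \<^bold>= t \<^bold>\<longrightarrow> inst \<phi> s \<^bold>\<longrightarrow> inst \<phi> t) \<in> logical_axioms"


section \<open>The theories \<open>Q\<^sup>-\<close> and \<open>Q\<close>\<close>

definition ordered_field_axioms :: "fm set" where
  "ordered_field_axioms =
    {\<^bold>\<forall>\<^bold>\<forall>\<^bold>\<forall> (Var 2 \<^bold>+ Var 1 \<^bold>+ Var 0 \<^bold>= Var 2 \<^bold>+ (Var 1 \<^bold>+ Var 0)),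
     \<^bold>\<forall>\<^bold>\<forall> (Var 1 \<^bold>+ Var 0 \<^bold>= Var 0 \<^bold>+ Var 1),
     \<^bold>\<forall> (Var 0 \<^bold>+ \<^bold>0 \<^bold>= Var 0),
     \<^bold>\<forall>\<^bold>\<forall> (Var 1 \<^bold>- Var 0 \<^bold>+ Var 0 \<^bold>= Var 1),
     \<^bold>\<forall>\<^bold>\<forall>\<^bold>\<forall> (Var 2 \<^bold>* Var 1 \<^bold>* Var 0 \<^bold>= Var 2 \<^bold>* (Var 1 \<^bold>* Var 0)),
     \<^bold>\<forall>\<^bold>\<forall> (Var 1 \<^bold>* Var 0 \<^bold>= Var 0 \<^bold>* Var 1),
     \<^bold>\<forall> (Var 0 \<^bold>* \<^bold>1 \<^bold>= Var 0),
     \<^bold>\<forall>\<^bold>\<forall>\<^bold>\<forall> (Var 2 \<^bold>* (Var 1 \<^bold>+ Var 0) \<^bold>= Var 2 \<^bold>* Var 1 \<^bold>+ Var 2 \<^bold>* Var 0),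
     \<^bold>\<not> \<^bold>0 \<^bold>= \<^bold>1,
     \<^bold>\<forall>\<^bold>\<forall> (\<^bold>\<not> Var 0 \<^bold>= \<^bold>0 \<^bold>\<longrightarrow> Var 1 \<^bold>/ Var 0 \<^bold>* Var 0 \<^bold>= Var 1),
     \<^bold>\<forall> (Var 0 \<^bold>/ \<^bold>0 \<^bold>= \<^bold>0),
     \<^bold>\<forall>\<^bold>\<forall> (Var 1 \<^bold>\<le> Var 0 \<^bold>\<or> Var 0 \<^bold>\<le> Var 1),
     \<^bold>\<forall>\<^bold>\<forall> (Var 1 \<^bold>\<le> Var 0 \<^bold>\<and> Var 0 \<^bold>\<le> Var 1 \<^bold>\<longrightarrow> Var 1 \<^bold>= Var 0),
     \<^bold>\<forall>\<^bold>\<forall>\<^bold>\<forall> (Var 2 \<^bold>\<le> Var 1 \<^bold>\<and> Var 1 \<^bold>\<le> Var 0 \<^bold>\<longrightarrow> Var 2 \<^bold>\<le> Var 0),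
     \<^bold>\<forall>\<^bold>\<forall>\<^bold>\<forall> (Var 2 \<^bold>\<le> Var 1 \<^bold>\<longrightarrow> Var 2 \<^bold>+ Var 0 \<^bold>\<le> Var 1 \<^bold>+ Var 0),
     \<^bold>\<forall>\<^bold>\<forall> (\<^bold>0 \<^bold>\<le> Var 1 \<^bold>\<and> \<^bold>0 \<^bold>\<le> Var 0 \<^bold>\<longrightarrow> \<^bold>0 \<^bold>\<le> Var 1 \<^bold>* Var 0)}"

definition fraction_axiom :: fm where
  "fraction_axiom =
     \<^bold>\<forall> \<^bold>\<exists>\<^sub>N \<^bold>\<exists>\<^sub>N \<^bold>\<exists>\<^sub>N (\<^bold>\<not> Var 0 \<^bold>= \<^bold>0 \<^bold>\<and> Var 3 \<^bold>= (Var 2 \<^bold>- Var 1) \<^bold>/ Var 0)"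

definition peano_axioms :: "fm set" where
  "peano_axioms =
    {N \<^bold>0,
     \<^bold>\<forall>\<^sub>N (N (Var 0 \<^bold>+ \<^bold>1)),
     \<^bold>\<forall>\<^sub>N (\<^bold>\<not> Var 0 \<^bold>+ \<^bold>1 \<^bold>= \<^bold>0),
     \<^bold>\<forall>\<^sub>N \<^bold>\<forall>\<^sub>N (Var 1 \<^bold>+ \<^bold>1 \<^bold>= Var 0 \<^bold>+ \<^bold>1 \<^bold>\<longrightarrow> Var 1 \<^bold>= Var 0),
     \<^bold>\<forall>\<^sub>N (Var 0 \<^bold>+ \<^bold>0 \<^bold>= Var 0),
     \<^bold>\<forall>\<^sub>N \<^bold>\<forall>\<^sub>N (Var 1 \<^bold>+ (Var 0 \<^bold>+ \<^bold>1) \<^bold>= Var 1 \<^bold>+ Var 0 \<^bold>+ \<^bold>1),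
     \<^bold>\<forall>\<^sub>N (Var 0 \<^bold>* \<^bold>0 \<^bold>= \<^bold>0),
     \<^bold>\<forall>\<^sub>N \<^bold>\<forall>\<^sub>N (Var 1 \<^bold>* (Var 0 \<^bold>+ \<^bold>1) \<^bold>= Var 1 \<^bold>* Var 0 \<^bold>+ Var 1)}"

text \<open>
  The induction variable is \<open>Var 0\<close>; the other free variables of \<open>\<phi>\<close> are parameters. The
  substitution replaces \<open>Var 0\<close> by its successor and leaves the parameters alone.
\<close>

definition induction :: "fm \<Rightarrow> fm" where
  "induction \<phi> =
     (inst \<phi> \<^bold>0 \<^bold>\<and> \<^bold>\<forall>\<^sub>N (\<phi> \<^bold>\<longrightarrow> subst (case_nat (Var 0 \<^bold>+ \<^bold>1) (\<lambda>i. Var (Suc i))) \<phi>) \<^bold>\<longrightarrow> \<^bold>\<forall>\<^sub>N \<phi>)"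

text \<open>
  \<open>Q\<^sup>-\<close> is given by a set \<open>A\<close> of single axioms, together with the induction scheme; \<open>A\<close> may be any
  set of \<open>\<L>\<close>-sentences true in the standard structure that contains the axioms above.
\<close>

definition Q_minus :: "fm set \<Rightarrow> fm set"
  where "Q_minus A = A \<union> {induction \<phi> | \<phi>. pr_free \<phi>}"

definition Q :: "fm set \<Rightarrow> fm set"
  where "Q A = A \<union> {induction \<phi> | \<phi>. True}"

definition standard_rational_theory :: "fm set \<Rightarrow> bool" where
  "standard_rational_theory A \<longleftrightarrow>
     (\<forall>\<phi> \<in> A. sentence \<phi> \<and> pr_free \<phi>) \<and>
     (\<forall>\<phi> \<in> Q_minus A. \<forall>P. true_in P \<phi>) \<and>
     ordered_field_axioms \<union> {fraction_axiom} \<union> peano_axioms \<subseteq> A"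


section \<open>The theory \<open>RKf\<close>\<close>

text \<open>
  Where \<open>Pr(x)\<close> occurs as a term, the axiom says that there are values \<open>u\<close>, \<dots> with \<open>Pr(x, u)\<close>, \<dots>
  for which the rest holds; likewise for the value of a term and \<open>Val\<close>.
\<close>

inductive_set pr_axioms :: "fm set" where
  pr_total: "\<^bold>\<forall> (Sent (Var 0) \<^bold>\<longrightarrow> \<^bold>\<exists> (Pr (Var 1) (Var 0))) \<in> pr_axioms"
| pr_unique: "\<^bold>\<forall>\<^bold>\<forall>\<^bold>\<forall> (Pr (Var 2) (Var 1) \<^bold>\<and> Pr (Var 2) (Var 0) \<^bold>\<longrightarrow> Var 1 \<^bold>= Var 0) \<in> pr_axioms"
| pr_range:
    "\<^bold>\<forall>\<^bold>\<forall> (Pr (Var 1) (Var 0) \<^bold>\<longrightarrow> Sent (Var 1) \<^bold>\<and> \<^bold>0 \<^bold>\<le> Var 0 \<^bold>\<and> Var 0 \<^bold>\<le> \<^bold>1) \<in> pr_axioms"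
| pr_reflect: \<comment> \<open>t = Var 1, value of t = Var 0\<close>
    "pr_free \<phi> \<Longrightarrow> fm_below 1 \<phi> \<Longrightarrow>
     \<^bold>\<forall> (ConstTerm (Var 0) \<^bold>\<longrightarrow>
        \<^bold>\<exists> (Val (Var 1) (Var 0) \<^bold>\<and> (Pr (sub_code 0 (Var 1) \<phi>) \<^bold>1 \<^bold>\<longleftrightarrow> \<phi>))) \<in> pr_axioms"
| pr_dis_left: \<comment> \<open>x = Var 3, y = Var 2, u = Var 1, v = Var 0\<close>
    "\<^bold>\<forall>\<^bold>\<forall> (Sent (Var 1) \<^bold>\<and> Sent (Var 0) \<^bold>\<longrightarrow>
        \<^bold>\<exists>\<^bold>\<exists> (Pr (Var 3) (Var 1) \<^bold>\<and> Pr (dis_code (Var 3) (Var 2)) (Var 0) \<^bold>\<and> Var 1 \<^bold>\<le> Var 0))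
     \<in> pr_axioms"
| pr_dis_right:
    "\<^bold>\<forall>\<^bold>\<forall> (Sent (Var 1) \<^bold>\<and> Sent (Var 0) \<^bold>\<longrightarrow>
        \<^bold>\<exists>\<^bold>\<exists> (Pr (Var 2) (Var 1) \<^bold>\<and> Pr (dis_code (Var 3) (Var 2)) (Var 0) \<^bold>\<and> Var 1 \<^bold>\<le> Var 0))
     \<in> pr_axioms"
| pr_additive: \<comment> \<open>x = Var 5, y = Var 4\<close>
    "\<^bold>\<forall>\<^bold>\<forall> (Sent (Var 1) \<^bold>\<and> Sent (Var 0) \<^bold>\<longrightarrow>
        \<^bold>\<exists>\<^bold>\<exists>\<^bold>\<exists>\<^bold>\<exists> (Pr (dis_code (Var 5) (Var 4)) (Var 3) \<^bold>\<and> Pr (Var 5) (Var 2) \<^bold>\<and> Pr (Var 4) (Var 1) \<^bold>\<and>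
              Pr (con_code (Var 5) (Var 4)) (Var 0) \<^bold>\<and> Var 3 \<^bold>= Var 2 \<^bold>+ Var 1 \<^bold>- Var 0))
     \<in> pr_axioms"
| pr_neg: \<comment> \<open>x = Var 2\<close>
    "\<^bold>\<forall> (Sent (Var 0) \<^bold>\<longrightarrow>
        \<^bold>\<exists>\<^bold>\<exists> (Pr (neg_code (Var 2)) (Var 1) \<^bold>\<and> Pr (Var 2) (Var 0) \<^bold>\<and> Var 1 \<^bold>= \<^bold>1 \<^bold>- Var 0))
     \<in> pr_axioms"

inductive RKf :: "fm set \<Rightarrow> fm \<Rightarrow> bool" for Qax :: "fm set" where
  logic: "\<phi> \<in> logical_axioms \<Longrightarrow> RKf Qax \<phi>"
| base: "\<phi> \<in> Qax \<Longrightarrow> RKf Qax \<phi>"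
| prob: "\<phi> \<in> pr_axioms \<Longrightarrow> RKf Qax \<phi>"
| mp: "RKf Qax (\<phi> \<^bold>\<longrightarrow> \<psi>) \<Longrightarrow> RKf Qax \<phi> \<Longrightarrow> RKf Qax \<psi>"
| gen: "RKf Qax \<phi> \<Longrightarrow> RKf Qax (\<^bold>\<forall> \<phi>)"
| nec: "RKf Qax \<phi> \<Longrightarrow> sentence \<phi> \<Longrightarrow> RKf Qax (Pr (num (code \<phi>)) \<^bold>1)"

definition omega_consistent :: "(fm \<Rightarrow> bool) \<Rightarrow> bool" where
  "omega_consistent T \<longleftrightarrow>
     \<not> (\<exists>\<phi>. fm_below 1 \<phi> \<and> (\<forall>n. T (inst \<phi> (num n))) \<and> T (\<^bold>\<exists>\<^sub>N (\<^bold>\<not> \<phi>)))"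

end

(*
  Probabilities are taken to be 0 or 1, so that a probability is the characteristic function of a
  set T of sentences. The revision sequence starts with the sentences true when Pr is empty and
  passes from T to the set of sentences true when Pr is read as membership in T. Every stage
  satisfies the axioms, and a theorem whose derivation nests necessitation k times holds from stage
  k on. A diagonal subsequence decides every sentence eventually; the sentences eventually accepted
  along it form a finitely additive 0-1 probability that contains all theorems.
*)
theory Submission
  imports Defs "HOL-Library.Infinite_Set" "HOL-Library.Diagonal_Subsequence"
begin

section \<open>Substitution and free variables\<close>

text \<open>No single stage need contain all theorems, since every nesting of necessitation may cost
  one more stage; hence the passage to a limit. The obstacle there is that the limit set
  \<open>T\<close> may differ from the set of sentences true in \<open>prob T\<close>. Soundness
  asks for less: the axioms require \<open>T\<close> to respect the finite connectives and to be
  right about \<open>Pr\<close>-free sentences (\<open>coherent\<close>), and necessitation requires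
  \<open>T\<close> to contain the theorems. Both survive the limit. Quantifiers may not: every
  instance of a universal sentence may be accepted eventually while the stages at which they settle
  are unbounded. This is why the probability obtained is finitely additive. The domain never
  changes, so \<open>N\<close> stays standard and \<omega>-consistency follows. Since the axioms
  speak about codes, much of the work is to show that \<open>Sent\<close>, \<open>ConstTerm\<close>,
  \<open>Val\<close> and \<open>sub_code\<close> behave as intended in the rationals.\<close>

lemma eval_subst_tm: "eval e (subst_tm \<sigma> t) = eval (\<lambda>i. eval e (\<sigma> i)) t"
  by (induction t) auto

lemma eval_shift_0 [simp]: "eval e (shift 0 t) = eval e t"
  by (simp add: shift_def eval_subst_tm)

lemma eval_shift_Suc [simp]: "eval (case_nat a e) (shift (Suc k) t) = eval e (shift k t)"
  by (simp add: shift_def eval_subst_tm)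

lemma eval_shift_numeral [simp]:
  "eval (case_nat a e) (shift (numeral k) t) = eval e (shift (pred_numeral k) t)"
  by (simp add: numeral_eq_Suc)

lemma sat_subst: "sat P e (subst \<sigma> \<phi>) \<longleftrightarrow> sat P (\<lambda>i. eval e (\<sigma> i)) \<phi>"
proof (induction \<phi> arbitrary: e \<sigma>)
  case (All \<phi>)
  have "(\<lambda>i. eval (case_nat a e) (case_nat (Var 0) (\<lambda>i. shift (Suc 0) (\<sigma> i)) i)) =
      case_nat a (\<lambda>i. eval e (\<sigma> i))" for a
    by (auto simp: fun_eq_iff split: nat.splits)
  then show ?case by (simp add: All)
qed (auto simp: eval_subst_tm)

lemma sat_inst: "sat P e (inst \<phi> t) \<longleftrightarrow> sat P (case_nat (eval e t) e) \<phi>"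
proof -
  have "(\<lambda>i. eval e (case_nat t Var i)) = case_nat (eval e t) e"
    by (auto simp: fun_eq_iff split: nat.splits)
  then show ?thesis by (simp add: inst_def sat_subst)
qed

lemma sat_lift: "sat P (case_nat a e) (lift \<phi>) \<longleftrightarrow> sat P e \<phi>"
  by (simp add: lift_def sat_subst)

lemma eval_below_cong: "tm_below n t \<Longrightarrow> \<forall>i<n. e i = e' i \<Longrightarrow> eval e t = eval e' t"
  by (induction t) auto

lemma sat_below_cong:
  "fm_below n \<phi> \<Longrightarrow> \<forall>i<n. e i = e' i \<Longrightarrow> sat P e \<phi> \<longleftrightarrow> sat P e' \<phi>"
proof (induction \<phi> arbitrary: n e e')
  case (All \<phi>)
  have "sat P (case_nat a e) \<phi> \<longleftrightarrow> sat P (case_nat a e') \<phi>" for a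
    by (rule All.IH[of "Suc n"]) (use All.prems in \<open>auto split: nat.splits\<close>)
  then show ?case by simp
next
  case (Eq s t)
  then show ?case using eval_below_cong[of n s e e'] eval_below_cong[of n t e e'] by simp
next
  case (Le s t)
  then show ?case using eval_below_cong[of n s e e'] eval_below_cong[of n t e e'] by simp
next
  case (N s)
  then show ?case using eval_below_cong[of n s e e'] by simp
next
  case (Pr s t)
  then show ?case using eval_below_cong[of n s e e'] eval_below_cong[of n t e e'] by simp
next
  case (Neg \<phi>)
  then show ?case using Neg.IH[of n e e'] by simp
next
  case (Con \<phi> \<psi>)
  then show ?case using Con.IH(1)[of n e e'] Con.IH(2)[of n e e'] by simp
next
  case (Dis \<phi> \<psi>)
  then show ?case using Dis.IH(1)[of n e e'] Dis.IH(2)[of n e e'] by simp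
qed

lemma true_in_sentence: "sentence \<phi> \<Longrightarrow> true_in P \<phi> \<longleftrightarrow> sat P e \<phi>"
  unfolding true_in_def using sat_below_cong[of 0 \<phi>] by blast

lemma sat_pr_free: "pr_free \<phi> \<Longrightarrow> sat P e \<phi> \<longleftrightarrow> sat P' e \<phi>"
  by (induction \<phi> arbitrary: e) auto

lemma pr_free_subst [simp]: "pr_free (subst \<sigma> \<phi>) \<longleftrightarrow> pr_free \<phi>"
  by (induction \<phi> arbitrary: \<sigma>) auto

lemma tm_below_subst_tm:
  "tm_below n t \<Longrightarrow> (\<And>i. i < n \<Longrightarrow> tm_below m (\<sigma> i)) \<Longrightarrow> tm_below m (subst_tm \<sigma> t)"
  by (induction t) auto

lemma tm_below_shift: "tm_below n t \<Longrightarrow> tm_below (n + k) (shift k t)"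
  unfolding shift_def by (erule tm_below_subst_tm) auto

lemma fm_below_subst:
  "fm_below n \<phi> \<Longrightarrow> (\<And>i. i < n \<Longrightarrow> tm_below m (\<sigma> i)) \<Longrightarrow> fm_below m (subst \<sigma> \<phi>)"
proof (induction \<phi> arbitrary: n m \<sigma>)
  case (All \<phi>)
  have "tm_below (Suc m) (case_nat (Var 0) (\<lambda>i. shift (Suc 0) (\<sigma> i)) i)" if "i < Suc n" for i
    using that All.prems(2) tm_below_shift[of m _ 1] by (cases i) auto
  then show ?case using All.IH[of "Suc n" "Suc m"] All.prems(1) by simp
qed (auto intro: tm_below_subst_tm)

lemma subst_tm_closed: "tm_below 0 t \<Longrightarrow> subst_tm \<sigma> t = t"
  by (induction t) auto

lemma shift_closed: "tm_below 0 t \<Longrightarrow> shift k t = t"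
  by (simp add: shift_def subst_tm_closed)

lemma eval_num [simp]: "eval e (num n) = of_nat n"
  by (induction n) (auto simp: add.commute)


section \<open>Codes\<close>

lemma code_tm_inj [simp]: "code_tm s = code_tm t \<longleftrightarrow> s = t"
  by (induction s arbitrary: t; case_tac t) auto

lemma code_inj [simp]: "code \<phi> = code \<psi> \<longleftrightarrow> \<phi> = \<psi>"
  by (induction \<phi> arbitrary: \<psi>; case_tac \<psi>) auto

text \<open>A triangular number is at least its index. Together with a positive tag this makes every
  component smaller than the composite code, on which the inductions over codes rest.\<close>

lemma prod_encode_ge: "a + b \<le> prod_encode (a, b)"
proof -
  have "n \<le> triangle n" for n by (induction n) auto
  then show ?thesis by (simp add: prod_encode_def trans_le_add1)
qed

lemma prod_encode_less: "0 < a \<Longrightarrow> b < prod_encode (a, b)"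
  using prod_encode_ge[of a b] by simp

lemma node_less:
  assumes "0 < a"
  shows "b < prod_encode (a, prod_encode (b, c))" "c < prod_encode (a, prod_encode (b, c))"
  using assms prod_encode_ge[of a "prod_encode (b, c)"] prod_encode_ge[of b c] by linarith+

section \<open>The Cantor pairing polynomial over the rationals\<close>

definition pair_val :: "rat \<Rightarrow> rat \<Rightarrow> rat"
  where "pair_val a b = (a + b) * (a + b + 1) / 2 + a"

lemma eval_pair [simp]: "eval e (pair s t) = pair_val (eval e s) (eval e t)"
proof -
  have "eval e (num 2) = 2" by simp
  then show ?thesis unfolding pair_def pair_val_def by (simp del: num.simps)
qed

lemma of_nat_triangle: "of_nat (triangle n) = (of_nat n * (of_nat n + 1) / 2 :: rat)"
  by (induction n) (auto simp: field_simps)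

lemma pair_val_of_nat [simp]:
  "pair_val (of_nat a) (of_nat b) = of_nat (prod_encode (a, b))"
  by (simp add: pair_val_def prod_encode_def of_nat_triangle)

text \<open>The simplifier evaluates \<open>of_nat\<close> at literals and sums, after which
  \<open>pair_val_of_nat\<close> no longer matches. This rule and the next two recover it for
  literal tags, zero and successors.\<close>

lemma pair_val_numeral [simp]:
  "pair_val (numeral k) (of_nat b) = of_nat (prod_encode (numeral k, b))"
  using pair_val_of_nat[of "numeral k" b] by (simp del: pair_val_of_nat)

lemma pair_val_0 [simp]: "pair_val 0 (of_nat b) = of_nat (prod_encode (0, b))"
  "pair_val (of_nat b) 0 = of_nat (prod_encode (b, 0))"
  using pair_val_of_nat[of 0 b] pair_val_of_nat[of b 0] by (simp_all del: pair_val_of_nat)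

lemma pair_val_plus_1 [simp]:
  "pair_val (of_nat a) (of_nat b + 1) = of_nat (prod_encode (a, Suc b))"
  using pair_val_of_nat[of a "Suc b"] by (simp add: add.commute del: pair_val_of_nat)

text \<open>This is the change that \<open>subst\<close> makes to a substitution at a quantifier, so
  its \<open>k\<close>-th iterate is the substitution that arrives below \<open>k\<close>
  quantifiers.\<close>

abbreviation under_all :: "(nat \<Rightarrow> tm) \<Rightarrow> nat \<Rightarrow> tm"
  where "under_all \<sigma> \<equiv> case_nat (Var 0) (\<lambda>i. shift (Suc 0) (\<sigma> i))"

lemma under_all_below: "i < k \<Longrightarrow> (under_all ^^ k) \<sigma> i = Var i"
  by (induction k arbitrary: i) (auto simp: shift_def split: nat.splits)

text \<open>Each quantifier shifts the substituted term, which leaves a closed term as it is. Hence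
  \<open>sub_code_tm\<close> can insert the same \<open>c\<close> at every depth.\<close>

lemma under_all_eq: "\<sigma> 0 = t \<Longrightarrow> tm_below 0 t \<Longrightarrow> (under_all ^^ k) \<sigma> k = t"
  by (induction k) (auto simp: shift_closed)

lemma eval_sub_code_tm:
  assumes "eval e c = of_nat (code_tm t)" "tm_below 0 t" "tm_below (Suc k) s"
  shows "eval e (sub_code_tm k c s) =
    of_nat (code_tm (subst_tm ((under_all ^^ k) (case_nat t Var)) s))"
  using assms(3)
proof (induction s)
  case (Var i)
  \<comment> \<open>The substitution lowers variables above \<open>k\<close>, whereas
    \<open>sub_code_tm\<close> keeps their codes; the bound \<open>Suc k\<close> excludes
    them.\<close>
  then have "i = k \<or> i < k" by auto
  then show ?case using assms(1,2) by (auto simp: under_all_below under_all_eq)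
qed simp_all

lemma eval_sub_code:
  assumes "eval e c = of_nat (code_tm t)" "tm_below 0 t"
  shows "fm_below (Suc k) \<phi> \<Longrightarrow> eval e (sub_code k c \<phi>) =
    of_nat (code (subst ((under_all ^^ k) (case_nat t Var)) \<phi>))"
  by (induction \<phi> arbitrary: k) (simp_all add: eval_sub_code_tm[OF assms])

lemma eval_sub_code_inst:
  assumes "eval e c = of_nat (code_tm t)" "tm_below 0 t" "fm_below 1 \<phi>"
  shows "eval e (sub_code 0 c \<phi>) = of_nat (code (inst \<phi> t))"
  unfolding inst_def using eval_sub_code[OF assms(1,2), of 0] assms(3) by simp


section \<open>Coding of finite sets\<close>

text \<open>The numbers \<open>1 + (x + 1) * m\<close> are the moduli of Goedel's beta function;
  here a set is read off from which of them divide \<open>d\<close>.\<close>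

definition coded_set :: "nat \<Rightarrow> nat \<Rightarrow> nat \<Rightarrow> nat set"
  where "coded_set b m d = {x. x \<le> b \<and> 1 + (x + 1) * m dvd d}"

text \<open>A common divisor is coprime to \<open>b!\<close> and divides
  \<open>(y - x) * b!\<close>, hence divides \<open>y - x\<close>. That difference is positive and
  at most \<open>b\<close>, so it divides \<open>b!\<close>, and the common divisor must divide
  1.\<close>

lemma coprime_progression:
  assumes "x < y" "y \<le> b"
  shows "coprime (1 + (x + 1) * fact b) (1 + (y + 1) * fact b :: nat)"
proof (rule coprimeI)
  fix c :: nat
  assume c: "c dvd 1 + (x + 1) * fact b" "c dvd 1 + (y + 1) * fact b"
  have "coprime (1 + (x + 1) * fact b) (fact b :: nat)"
    by (metis add.commute coprime_1_left gcd_add_mult coprime_iff_gcd_eq_1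
        gcd.commute)
  with c(1) have "coprime c (fact b)" by (metis coprime_divisors dvd_refl)
  moreover have "c dvd (y - x) * fact b"
    using dvd_diff_nat[OF c(2,1)] by (simp add: diff_mult_distrib)
  ultimately have "c dvd y - x" by (simp add: coprime_dvd_mult_left_iff)
  also have "y - x dvd fact b" using assms by (intro dvd_fact) auto
  finally have "c dvd (x + 1) * fact b" by simp
  with c(1) show "is_unit c" by (metis dvd_add_left_iff)
qed

text \<open>Let \<open>b\<close> bound the set, \<open>m = b!\<close>, and let \<open>d\<close> be
  the product of the moduli of the members. The modulus of a non-member up to \<open>b\<close> is
  coprime to \<open>d\<close> and exceeds 1, so it does not divide \<open>d\<close>.\<close>

lemma ex_coded_set:
  assumes "finite S"
  shows "\<exists>b m d. coded_set b m d = S"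
proof -
  obtain b where b: "\<And>x. x \<in> S \<Longrightarrow> x \<le> b"
    using assms by (metis Max_ge)
  define f :: "nat \<Rightarrow> nat" where "f x = 1 + (x + 1) * fact b" for x
  have "f x dvd prod f S \<longleftrightarrow> x \<in> S" if "x \<le> b" for x
  proof
    assume dvd: "f x dvd prod f S"
    show "x \<in> S"
    proof (rule ccontr)
      assume "x \<notin> S"
      have "coprime (f x) (f y)" if "y \<in> S" for y
      proof (cases "x < y")
        case True
        then show ?thesis unfolding f_def using b[OF that] by (rule coprime_progression)
      next
        case False
        with that \<open>x \<notin> S\<close> have "y < x" by (metis linorder_neqE_nat)
        then show ?thesis
          unfolding f_def coprime_commute[of "1 + (x + 1) * _"]
          using \<open>x \<le> b\<close> by (rule coprime_progression)
      qed
      then have "coprime (f x) (prod f S)" by (intro prod_coprime_right) auto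
      with dvd have "is_unit (f x)" using coprime_common_divisor dvd_refl by blast
      then show False by (simp add: f_def)
    qed
  next
    assume "x \<in> S"
    with assms show "f x dvd prod f S" by (rule dvd_prodI)
  qed
  then have "coded_set b (fact b) (prod f S) = S"
    using b by (auto simp: coded_set_def f_def)
  then show ?thesis by blast
qed

text \<open>The quotient \<open>k\<close> has to be a natural number, because divisibility is
  trivial in the field of rationals.\<close>

definition mem_val :: "rat \<Rightarrow> rat \<Rightarrow> rat \<Rightarrow> rat \<Rightarrow> bool" where
  "mem_val x b m d \<longleftrightarrow> x \<in> \<nat> \<and> x \<le> b \<and> (\<exists>k\<in>\<nat>. k * (1 + (x + 1) * m) = d)"

lemma sat_Mem: "sat P e (Mem x b m d) \<longleftrightarrow> mem_val (eval e x) (eval e b) (eval e m) (eval e d)"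
  by (simp add: Mem_def mem_val_def Bex_def)

lemma mem_val_of_nat:
  "mem_val (of_nat x) (of_nat b) (of_nat m) (of_nat d) \<longleftrightarrow> x \<in> coded_set b m d"
proof -
  have "(\<exists>k\<in>\<nat>. k * (1 + (of_nat x + 1) * of_nat m) = (of_nat d :: rat)) \<longleftrightarrow>
      (\<exists>k::nat. of_nat k * (1 + (of_nat x + 1) * of_nat m) = (of_nat d :: rat))"
    by (auto simp: Nats_def)
  also have "\<dots> \<longleftrightarrow> (\<exists>k::nat. of_nat (k * (1 + (x + 1) * m)) = (of_nat d :: rat))"
    by (simp add: algebra_simps)
  also have "\<dots> \<longleftrightarrow> 1 + (x + 1) * m dvd d"
    unfolding of_nat_eq_iff by (auto simp: dvd_def mult.commute)
  finally show ?thesis by (simp add: mem_val_def coded_set_def)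
qed

lemma sat_ExN: "sat P e (\<^bold>\<exists>\<^sub>N \<phi>) \<longleftrightarrow> (\<exists>k::nat. sat P (case_nat (of_nat k) e) \<phi>)"
  unfolding sat.simps eval.simps nat.case by (metis Nats_cases of_nat_in_Nats)

lemma sat_AllN: "sat P e (\<^bold>\<forall>\<^sub>N \<phi>) \<longleftrightarrow> (\<forall>k::nat. sat P (case_nat (of_nat k) e) \<phi>)"
  unfolding sat.simps eval.simps nat.case by (metis Nats_cases of_nat_in_Nats)

text \<open>\<open>Less\<close> and the implications guarded by \<open>Mem\<close> hide negations.
  Once the generic clause for negation is removed, these two shapes need rules of their own.\<close>

lemma sat_Neg_atom:
  "sat P e (\<^bold>\<not> s \<^bold>= t) \<longleftrightarrow> eval e s \<noteq> eval e t"
  "sat P e (\<^bold>\<not> Mem x b m d) \<longleftrightarrow> \<not> mem_val (eval e x) (eval e b) (eval e m) (eval e d)"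
  by (simp_all add: sat_Mem)

text \<open>
  The generic clauses for negation and quantification would match \<open>\<^bold>\<exists>\<^sub>N\<close> and \<open>\<^bold>\<forall>\<^sub>N\<close> first and produce
  quantifiers over the rationals; they must be deleted wherever these rules are used.
\<close>

lemmas sat_simps = sat_ExN sat_AllN sat_Mem sat_Neg_atom


section \<open>Correctness of the arithmetized syntax\<close>

lemma sat_Term_of_nat:
  assumes "eval e x = of_nat x'" "eval e n = of_nat n'"
  shows "sat P e (Term x n) \<longleftrightarrow>
    (\<exists>b m d. x' \<in> coded_set b m d \<and>
      (\<forall>y \<in> coded_set b m d.
         (\<exists>i<n'. y = code_tm (Var i)) \<or> y = code_tm \<^bold>0 \<or> y = code_tm \<^bold>1 \<or>
         (\<exists>s \<in> coded_set b m d. \<exists>t \<in> coded_set b m d.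
            y = prod_encode (3, prod_encode (s, t)) \<or> y = prod_encode (4, prod_encode (s, t)) \<or>
            y = prod_encode (5, prod_encode (s, t)) \<or> y = prod_encode (6, prod_encode (s, t)))))"
  unfolding Term_def
  by (simp add: sat_simps mem_val_of_nat assms Ball_def Bex_def less_le
      del: num.simps sat.simps(5,8))

lemma sat_Term_Nats: "sat P e (Term x n) \<Longrightarrow> eval e x \<in> \<nat>"
  unfolding Term_def sat_ExN by (auto simp: sat_Mem mem_val_def)

text \<open>Every member of a justified set codes a term, by strong induction, since composites
  exceed their components. Conversely, the codes up to \<open>code_tm t\<close> of terms with
  variables below \<open>n'\<close> form a finite set that contains the components of each of its
  members.\<close>

lemma sat_Term:
  assumes n: "eval e n = of_nat n'"
  shows "sat P e (Term x n) \<longleftrightarrow> (\<exists>t. tm_below n' t \<and> eval e x = of_nat (code_tm t))"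
proof
  assume sat: "sat P e (Term x n)"
  then obtain x' where x: "eval e x = of_nat x'"
    using sat_Term_Nats by (metis Nats_cases)
  obtain b m d where x': "x' \<in> coded_set b m d"
    and step: "\<And>y. y \<in> coded_set b m d \<Longrightarrow>
         (\<exists>i<n'. y = code_tm (Var i)) \<or> y = code_tm \<^bold>0 \<or> y = code_tm \<^bold>1 \<or>
         (\<exists>s \<in> coded_set b m d. \<exists>t \<in> coded_set b m d.
            y = prod_encode (3, prod_encode (s, t)) \<or> y = prod_encode (4, prod_encode (s, t)) \<or>
            y = prod_encode (5, prod_encode (s, t)) \<or> y = prod_encode (6, prod_encode (s, t)))"
    using sat[unfolded sat_Term_of_nat[OF x n]] by blast
  have "\<exists>t. tm_below n' t \<and> y = code_tm t" if "y \<in> coded_set b m d" for y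
    using that
  proof (induction y rule: less_induct)
    case (less y)
    consider i where "i < n'" "y = code_tm (Var i)" | "y = code_tm \<^bold>0" | "y = code_tm \<^bold>1"
      | k s t where "k \<in> {3, 4, 5, 6}" "y = prod_encode (k, prod_encode (s, t))"
          "s \<in> coded_set b m d" "t \<in> coded_set b m d"
      using step[OF less.prems] by blast
    then show ?case
    proof cases
      case 4
      then have "s < y" "t < y" using node_less by auto
      then obtain s' t' where "tm_below n' s'" "s = code_tm s'" "tm_below n' t'" "t = code_tm t'"
        using less.IH 4 by meson
      then have "tm_below n' (s' \<^bold>+ t')" "tm_below n' (s' \<^bold>- t')"
          "tm_below n' (s' \<^bold>* t')" "tm_below n' (s' \<^bold>/ t')"
        "y \<in> {code_tm (s' \<^bold>+ t'), code_tm (s' \<^bold>- t'), code_tm (s' \<^bold>* t'), code_tm (s' \<^bold>/ t')}"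
        using 4 by auto
      then show ?thesis by blast
    qed (metis tm_below.simps)+
  qed
  then show "\<exists>t. tm_below n' t \<and> eval e x = of_nat (code_tm t)"
    using x x' by blast
next
  assume "\<exists>t. tm_below n' t \<and> eval e x = of_nat (code_tm t)"
  then obtain t where t: "tm_below n' t" "eval e x = of_nat (code_tm t)" by blast
  define S where "S = code_tm ` {s. tm_below n' s \<and> code_tm s \<le> code_tm t}"
  have "finite S"
    unfolding S_def by (rule finite_subset[of _ "{..code_tm t}"]) auto
  then obtain b m d where S: "coded_set b m d = S" using ex_coded_set by blast
  have "(\<exists>i<n'. y = code_tm (Var i)) \<or> y = code_tm \<^bold>0 \<or> y = code_tm \<^bold>1 \<or>
         (\<exists>s \<in> S. \<exists>t \<in> S.
            y = prod_encode (3, prod_encode (s, t)) \<or> y = prod_encode (4, prod_encode (s, t)) \<or>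
            y = prod_encode (5, prod_encode (s, t)) \<or> y = prod_encode (6, prod_encode (s, t)))"
    if "y \<in> S" for y
  proof -
    obtain s where s: "y = code_tm s" "tm_below n' s" "code_tm s \<le> code_tm t"
      using \<open>y \<in> S\<close> unfolding S_def by blast
    have mem: "code_tm r \<in> S" if "code_tm r < y" "tm_below n' r" for r
      unfolding S_def using that s by auto
    show ?thesis
      using s(1,2) mem by (cases s) (auto simp: node_less)
  qed
  moreover have "code_tm t \<in> S" using t(1) unfolding S_def by blast
  ultimately show "sat P e (Term x n)"
    unfolding sat_Term_of_nat[OF t(2) n] using S by blast
qed

text \<open>Inside \<open>Form\<close> the bound on the variables is itself a quantified variable.
  As a rewrite rule this version has only a side condition on \<open>eval e n\<close>, which the
  simplifier can discharge there.\<close>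

lemma sat_Term':
  "eval e n \<in> \<nat> \<Longrightarrow> sat P e (Term x n) \<longleftrightarrow>
    (\<exists>k t. eval e n = of_nat k \<and> tm_below k t \<and> eval e x = of_nat (code_tm t))"
  by (auto simp: Nats_def sat_Term)

section \<open>Codes of formulas\<close>

lemma sat_Form_of_nat:
  assumes "eval e x = of_nat x'" "eval e n = of_nat n'"
  shows "sat P e (Form x n) \<longleftrightarrow>
    (\<exists>b m d. prod_encode (x', n') \<in> coded_set b m d \<and>
      (\<forall>y k. prod_encode (y, k) \<in> coded_set b m d \<longrightarrow>
         (\<exists>p q. (\<exists>s. tm_below k s \<and> p = code_tm s) \<and> (\<exists>t. tm_below k t \<and> q = code_tm t) \<and>
            (y = prod_encode (7, prod_encode (p, q)) \<or> y = prod_encode (8, prod_encode (p, q)) \<or>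
             y = prod_encode (9, p) \<or> y = prod_encode (10, prod_encode (p, q)))) \<or>
         (\<exists>u v. prod_encode (u, k) \<in> coded_set b m d \<and> prod_encode (v, k) \<in> coded_set b m d \<and>
            (y = prod_encode (11, u) \<or> y = prod_encode (12, prod_encode (u, v)) \<or>
             y = prod_encode (13, prod_encode (u, v)))) \<or>
         (\<exists>u. prod_encode (u, Suc k) \<in> coded_set b m d \<and> y = prod_encode (14, u))))"
  unfolding Form_def
  by (simp add: sat_simps mem_val_of_nat sat_Term' assms del: num.simps sat.simps(5,8))

lemma sat_Form:
  assumes n: "eval e n = of_nat n'"
  shows "sat P e (Form x n) \<longleftrightarrow> (\<exists>\<phi>. fm_below n' \<phi> \<and> eval e x = of_nat (code \<phi>))"
proof
  assume sat: "sat P e (Form x n)"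
  then have "eval e x \<in> \<nat>" by (simp add: Form_def)
  then obtain x' where x: "eval e x = of_nat x'" by (metis Nats_cases)
  obtain b m d where x': "prod_encode (x', n') \<in> coded_set b m d"
    and step: "\<And>y k. prod_encode (y, k) \<in> coded_set b m d \<Longrightarrow>
         (\<exists>p q. (\<exists>s. tm_below k s \<and> p = code_tm s) \<and> (\<exists>t. tm_below k t \<and> q = code_tm t) \<and>
            (y = prod_encode (7, prod_encode (p, q)) \<or> y = prod_encode (8, prod_encode (p, q)) \<or>
             y = prod_encode (9, p) \<or> y = prod_encode (10, prod_encode (p, q)))) \<or>
         (\<exists>u v. prod_encode (u, k) \<in> coded_set b m d \<and> prod_encode (v, k) \<in> coded_set b m d \<and>
            (y = prod_encode (11, u) \<or> y = prod_encode (12, prod_encode (u, v)) \<or>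
             y = prod_encode (13, prod_encode (u, v)))) \<or>
         (\<exists>u. prod_encode (u, Suc k) \<in> coded_set b m d \<and> y = prod_encode (14, u))"
    using sat[unfolded sat_Form_of_nat[OF x n]] by blast
  have "\<exists>\<phi>. fm_below k \<phi> \<and> y = code \<phi>" if "prod_encode (y, k) \<in> coded_set b m d" for y k
    using that
  \<comment> \<open>At a quantifier the bound grows from \<open>k\<close> to \<open>Suc k\<close>;
    only the code decreases, so \<open>k\<close> is generalised.\<close>
  proof (induction y arbitrary: k rule: less_induct)
    case (less y)
    consider
        s t where "tm_below k s" "tm_below k t"
          "y \<in> {code (s \<^bold>= t), code (s \<^bold>\<le> t), code (N s), code (Pr s t)}"
      | u where "y = prod_encode (11, u)" "prod_encode (u, k) \<in> coded_set b m d"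
      | i u v where "i \<in> {12, 13}" "y = prod_encode (i, prod_encode (u, v))"
          "prod_encode (u, k) \<in> coded_set b m d" "prod_encode (v, k) \<in> coded_set b m d"
      | u where "y = prod_encode (14, u)" "prod_encode (u, Suc k) \<in> coded_set b m d"
      using step[OF less.prems] by fastforce
    then show ?case
    proof cases
      case 1
      then have "fm_below k (s \<^bold>= t)" "fm_below k (s \<^bold>\<le> t)" "fm_below k (N s)" "fm_below k (Pr s t)"
        by simp_all
      with 1(3) show ?thesis by blast
    next
      case 2
      then have "u < y" using prod_encode_less by simp
      with 2 obtain \<phi> where "fm_below k \<phi>" "u = code \<phi>" using less.IH by blast
      with 2 have "fm_below k (\<^bold>\<not> \<phi>)" "y = code (\<^bold>\<not> \<phi>)" by simp_all
      then show ?thesis by blast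
    next
      case 3
      then have "u < y" "v < y" using node_less by auto
      then obtain \<phi> \<psi> where "fm_below k \<phi>" "u = code \<phi>" "fm_below k \<psi>" "v = code \<psi>"
        using less.IH 3 by meson
      then have "fm_below k (\<phi> \<^bold>\<and> \<psi>)" "fm_below k (\<phi> \<^bold>\<or> \<psi>)" "y \<in> {code (\<phi> \<^bold>\<and> \<psi>), code (\<phi> \<^bold>\<or> \<psi>)}"
        using 3 by auto
      then show ?thesis by blast
    next
      case 4
      then have "u < y" using prod_encode_less by simp
      with 4 obtain \<phi> where "fm_below (Suc k) \<phi>" "u = code \<phi>" using less.IH by blast
      with 4 have "fm_below k (\<^bold>\<forall> \<phi>)" "y = code (\<^bold>\<forall> \<phi>)" by simp_all
      then show ?thesis by blast
    qed
  qed
  then show "\<exists>\<phi>. fm_below n' \<phi> \<and> eval e x = of_nat (code \<phi>)"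
    using x x' by blast
next
  assume "\<exists>\<phi>. fm_below n' \<phi> \<and> eval e x = of_nat (code \<phi>)"
  then obtain \<phi> where \<phi>: "fm_below n' \<phi>" "eval e x = of_nat (code \<phi>)" by blast
  \<comment> \<open>Passing a quantifier raises \<open>k\<close> by one and lowers the code, so the sum bounds both.\<close>
  define S where "S = {prod_encode (code \<psi>, k) | \<psi> k. fm_below k \<psi> \<and> code \<psi> + k \<le> code \<phi> + n'}"
  have "finite S"
    unfolding S_def
    by (rule finite_subset[of _ "prod_encode ` ({..code \<phi> + n'} \<times> {..code \<phi> + n'})"]) auto
  then obtain b m d where S: "coded_set b m d = S" using ex_coded_set by blast
  have "(\<exists>p q. (\<exists>s. tm_below k s \<and> p = code_tm s) \<and> (\<exists>t. tm_below k t \<and> q = code_tm t) \<and>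
            (y = prod_encode (7, prod_encode (p, q)) \<or> y = prod_encode (8, prod_encode (p, q)) \<or>
             y = prod_encode (9, p) \<or> y = prod_encode (10, prod_encode (p, q)))) \<or>
         (\<exists>u v. prod_encode (u, k) \<in> S \<and> prod_encode (v, k) \<in> S \<and>
            (y = prod_encode (11, u) \<or> y = prod_encode (12, prod_encode (u, v)) \<or>
             y = prod_encode (13, prod_encode (u, v)))) \<or>
         (\<exists>u. prod_encode (u, Suc k) \<in> S \<and> y = prod_encode (14, u))"
    if "prod_encode (y, k) \<in> S" for y k
  proof -
    obtain \<psi> where \<psi>: "y = code \<psi>" "fm_below k \<psi>" "code \<psi> + k \<le> code \<phi> + n'"
      using \<open>prod_encode (y, k) \<in> S\<close> unfolding S_def by auto
    have mem: "prod_encode (code \<chi>, j) \<in> S" if "code \<chi> + j \<le> y + k" "fm_below j \<chi>" for \<chi> j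
      unfolding S_def using that \<psi> by fastforce
    show ?thesis
    proof (cases \<psi>)
      case (Neg \<chi>)
      then have "prod_encode (code \<chi>, k) \<in> S"
        using \<psi> by (intro mem) (auto intro: le_prod_encode_2)
      then show ?thesis using Neg \<psi> by auto
    next
      case (All \<chi>)
      then have "prod_encode (code \<chi>, Suc k) \<in> S"
        using \<psi> by (intro mem) (auto intro!: Suc_leI prod_encode_less)
      then show ?thesis using All \<psi> by auto
    next
      case (Con \<chi> \<chi>')
      then have "prod_encode (code \<chi>, k) \<in> S" "prod_encode (code \<chi>', k) \<in> S"
        using \<psi> by (auto intro!: mem less_imp_le node_less)
      then show ?thesis using Con \<psi> by auto
    next
      case (Dis \<chi> \<chi>')
      then have "prod_encode (code \<chi>, k) \<in> S" "prod_encode (code \<chi>', k) \<in> S"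
        using \<psi> by (auto intro!: mem less_imp_le node_less)
      then show ?thesis using Dis \<psi> by auto
    qed (use \<psi> in auto)
  qed
  moreover have "prod_encode (code \<phi>, n') \<in> S" using \<phi>(1) unfolding S_def by blast
  ultimately show "sat P e (Form x n)"
    unfolding sat_Form_of_nat[OF \<phi>(2) n] using S by blast
qed

lemma sat_Sent [simp]:
  "sat P e (Sent x) \<longleftrightarrow> (\<exists>\<phi>. sentence \<phi> \<and> eval e x = of_nat (code \<phi>))"
  by (simp add: Sent_def sat_Form[of _ _ 0])

lemma sat_ConstTerm [simp]:
  "sat P e (ConstTerm x) \<longleftrightarrow> (\<exists>t. tm_below 0 t \<and> eval e x = of_nat (code_tm t))"
  by (simp add: ConstTerm_def sat_Term[of _ _ 0])

section \<open>Values of constant terms\<close>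

definition memq_val :: "rat \<Rightarrow> rat \<Rightarrow> rat \<Rightarrow> rat \<Rightarrow> rat \<Rightarrow> bool" where
  "memq_val x w b m d \<longleftrightarrow> (\<exists>p q r::nat. w = (of_nat p - of_nat q) / (of_nat r + 1) \<and>
     mem_val (pair_val x (of_nat (prod_encode (p, prod_encode (q, r))))) b m d)"

lemma sat_MemQ:
  "sat P e (MemQ x w b m d) \<longleftrightarrow>
    memq_val (eval e x) (eval e w) (eval e b) (eval e m) (eval e d)"
  by (simp add: MemQ_def memq_val_def sat_simps del: sat.simps(5,8))

text \<open>\<open>Val\<close> also quantifies over rational values, without relativisation to
  \<open>N\<close>. With the generic clauses for negation and quantification disabled, the shapes
  occurring there are treated separately.\<close>

lemma sat_quantified_MemQ:
  "sat P e (\<^bold>\<forall> (MemQ x w b m d \<^bold>\<longrightarrow> \<phi>)) \<longleftrightarrow>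
    (\<forall>a. sat P (case_nat a e) (MemQ x w b m d) \<longrightarrow> sat P (case_nat a e) \<phi>)"
  "sat P e (\<^bold>\<exists> (MemQ x w b m d \<^bold>\<and> \<phi>)) \<longleftrightarrow>
    (\<exists>a. sat P (case_nat a e) (MemQ x w b m d) \<and> sat P (case_nat a e) \<phi>)"
  "sat P e (\<^bold>\<exists> \<^bold>\<exists> \<phi>) \<longleftrightarrow> (\<exists>a. sat P (case_nat a e) (\<^bold>\<exists> \<phi>))"
  by auto

lemma sat_Val_of_nat:
  assumes "eval e x = of_nat x'"
  shows "sat P e (Val x w) \<longleftrightarrow> (\<exists>b m d :: nat.
    let G = (\<lambda>y z. memq_val (of_nat y) z (of_nat b) (of_nat m) (of_nat d)) in
    G x' (eval e w) \<and>
    (\<forall>y z. G y z \<longrightarrow> y = code_tm \<^bold>0 \<and> z = 0 \<or> y = code_tm \<^bold>1 \<and> z = 1 \<or>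
      (\<exists>s t s' t'. G s s' \<and> G t t' \<and>
        (y = prod_encode (3, prod_encode (s, t)) \<and> z = s' + t' \<or>
         y = prod_encode (4, prod_encode (s, t)) \<and> z = s' - t' \<or>
         y = prod_encode (5, prod_encode (s, t)) \<and> z = s' * t' \<or>
         y = prod_encode (6, prod_encode (s, t)) \<and> z = s' / t'))))"
  unfolding Val_def
  by (simp add: sat_simps sat_MemQ sat_quantified_MemQ assms Let_def del: num.simps sat.simps(5,8))

text \<open>Since \<open>nat\<close> sends negative integers to 0, the numerator is split into its
  positive and negative parts; the positive denominator is lowered by one to fit the form
  \<open>r + 1\<close>.\<close>

lemma rat_eq_nat_fraction:
  fixes w :: rat
  shows "w = (of_nat (nat (fst (quotient_of w))) - of_nat (nat (- fst (quotient_of w)))) /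
    (of_nat (nat (snd (quotient_of w)) - 1) + 1)"
proof -
  obtain a b where ab: "quotient_of w = (a, b)" by fastforce
  have "b > 0" using ab by (rule quotient_of_denom_pos)
  then show ?thesis
    using quotient_of_div[OF ab] ab by (cases "a \<ge> 0") (auto simp: of_nat_diff)
qed

text \<open>Each rational is entered through one chosen triple \<open>(p, q, r)\<close>. A pair
  found through some triple belongs to \<open>S\<close>, because the triple determines the
  rational.\<close>

lemma ex_coded_graph:
  assumes "finite S"
  shows "\<exists>b m d :: nat. \<forall>x w. memq_val (of_nat x) w (of_nat b) (of_nat m) (of_nat d) \<longleftrightarrow> (x, w) \<in> S"
proof -
  obtain p q r :: "rat \<Rightarrow> nat"
    where pqr: "\<And>w. w = (of_nat (p w) - of_nat (q w)) / (of_nat (r w) + 1)"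
    by (rule that[OF rat_eq_nat_fraction])
  obtain b m d where bmd: "coded_set b m d =
      (\<lambda>(x, w). prod_encode (x, prod_encode (p w, prod_encode (q w, r w)))) ` S"
    using ex_coded_set[OF finite_imageI[OF assms]] by meson
  have "memq_val (of_nat x) w (of_nat b) (of_nat m) (of_nat d) \<longleftrightarrow> (x, w) \<in> S" for x w
  proof
    assume "memq_val (of_nat x) w (of_nat b) (of_nat m) (of_nat d)"
    then obtain p' q' r' where w: "w = (of_nat p' - of_nat q') / (of_nat r' + 1)"
      and "prod_encode (x, prod_encode (p', prod_encode (q', r'))) \<in> coded_set b m d"
      unfolding memq_val_def by (auto simp: mem_val_of_nat)
    then obtain v where "(x, v) \<in> S" "p' = p v" "q' = q v" "r' = r v"
      unfolding bmd by auto
    then show "(x, w) \<in> S" using w by (simp add: pqr[symmetric])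
  next
    assume "(x, w) \<in> S"
    then have "prod_encode (x, prod_encode (p w, prod_encode (q w, r w))) \<in> coded_set b m d"
      unfolding bmd by force
    with pqr[of w] show "memq_val (of_nat x) w (of_nat b) (of_nat m) (of_nat d)"
      unfolding memq_val_def pair_val_of_nat mem_val_of_nat by blast
  qed
  then show ?thesis by blast
qed

text \<open>The reflection axiom asserts that a value exists, and this supplies it. The witnessing
  set is the graph of evaluation on the closed terms with code up to \<open>code_tm t\<close>, which
  is closed under subterms.\<close>

lemma sat_Val:
  assumes "tm_below 0 t" "eval e x = of_nat (code_tm t)" "eval e w = eval e t"
  shows "sat P e (Val x w)"
proof -
  define S where "S = (\<lambda>s. (code_tm s, eval e s)) ` {s. tm_below 0 s \<and> code_tm s \<le> code_tm t}"
  have "finite {s. tm_below 0 s \<and> code_tm s \<le> code_tm t}"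
    by (rule finite_imageD[of code_tm], rule finite_subset[of _ "{..code_tm t}"])
      (auto intro: inj_onI)
  then have "finite S" unfolding S_def by (rule finite_imageI)
  then obtain b m d :: nat where G:
    "\<And>y z. memq_val (of_nat y) z (of_nat b) (of_nat m) (of_nat d) \<longleftrightarrow> (y, z) \<in> S"
    using ex_coded_graph by meson
  have step: "y = code_tm \<^bold>0 \<and> z = 0 \<or> y = code_tm \<^bold>1 \<and> z = 1 \<or>
      (\<exists>s t s' t'. (s, s') \<in> S \<and> (t, t') \<in> S \<and>
        (y = prod_encode (3, prod_encode (s, t)) \<and> z = s' + t' \<or>
         y = prod_encode (4, prod_encode (s, t)) \<and> z = s' - t' \<or>
         y = prod_encode (5, prod_encode (s, t)) \<and> z = s' * t' \<or>
         y = prod_encode (6, prod_encode (s, t)) \<and> z = s' / t'))"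
    if "(y, z) \<in> S" for y z
  proof -
    obtain r where r: "y = code_tm r" "z = eval e r" "tm_below 0 r" "code_tm r \<le> code_tm t"
      using \<open>(y, z) \<in> S\<close> unfolding S_def by blast
    have mem: "(code_tm s, eval e s) \<in> S" if "code_tm s < y" "tm_below 0 s" for s
      unfolding S_def using that r by auto
    show ?thesis
    proof (cases r)
      case (Add u v)
      then have "(code_tm u, eval e u) \<in> S" "(code_tm v, eval e v) \<in> S"
        using r by (auto intro!: mem node_less)
      then show ?thesis using Add r(1,2) by auto
    next
      case (Sub u v)
      then have "(code_tm u, eval e u) \<in> S" "(code_tm v, eval e v) \<in> S"
        using r by (auto intro!: mem node_less)
      then show ?thesis using Sub r(1,2) by auto
    next
      case (Mul u v)
      then have "(code_tm u, eval e u) \<in> S" "(code_tm v, eval e v) \<in> S"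
        using r by (auto intro!: mem node_less)
      then show ?thesis using Mul r(1,2) by auto
    next
      case (Div u v)
      then have "(code_tm u, eval e u) \<in> S" "(code_tm v, eval e v) \<in> S"
        using r by (auto intro!: mem node_less)
      then show ?thesis using Div r(1,2) by auto
    qed (use r in auto)
  qed
  have "(code_tm t, eval e w) \<in> S" using assms unfolding S_def by auto
  then show ?thesis
    unfolding sat_Val_of_nat[OF assms(2)] Let_def
    by (intro exI[of _ b] exI[of _ m] exI[of _ d], unfold G) (use step in blast)
qed


section \<open>Models of the probability axioms\<close>

text \<open>Numbers that code no sentence receive no value, as the range axiom demands. Open
  formulas in \<open>T\<close> are ignored; the truth sets used later do contain some.\<close>

definition prob :: "fm set \<Rightarrow> rat \<Rightarrow> rat \<Rightarrow> bool" where
  "prob T x y \<longleftrightarrow> (\<exists>\<phi>. sentence \<phi> \<and> x = of_nat (code \<phi>) \<and> y = of_bool (\<phi> \<in> T))"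

lemma prob_code [simp]:
  "sentence \<phi> \<Longrightarrow> prob T (of_nat (code \<phi>)) y \<longleftrightarrow> y = of_bool (\<phi> \<in> T)"
  by (auto simp: prob_def)

text \<open>These are the conditions under which \<open>prob T\<close> satisfies the probability
  axioms: a two-valued assignment that respects the connectives is finitely additive, and the last
  clause gives reflection. Quantified sentences containing \<open>Pr\<close> are left unconstrained,
  so that the property can pass to limits.\<close>

definition coherent :: "fm set \<Rightarrow> bool" where
  "coherent T \<longleftrightarrow>
    (\<forall>\<phi>. sentence \<phi> \<longrightarrow> (\<^bold>\<not> \<phi> \<in> T \<longleftrightarrow> \<phi> \<notin> T)) \<and>
    (\<forall>\<phi> \<psi>. sentence \<phi> \<longrightarrow> sentence \<psi> \<longrightarrow>
      (\<phi> \<^bold>\<and> \<psi> \<in> T \<longleftrightarrow> \<phi> \<in> T \<and> \<psi> \<in> T) \<and> (\<phi> \<^bold>\<or> \<psi> \<in> T \<longleftrightarrow> \<phi> \<in> T \<or> \<psi> \<in> T)) \<and>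
    (\<forall>\<phi> P. sentence \<phi> \<longrightarrow> pr_free \<phi> \<longrightarrow> (\<phi> \<in> T \<longleftrightarrow> true_in P \<phi>))"

text \<open>For a sentence, truth under all assignments is truth under one, hence commutes with
  negation and disjunction; open formulas lack this.\<close>

lemma coherent_truth: "coherent {\<phi>. true_in P \<phi>}"
  unfolding coherent_def
  by (auto simp: true_in_sentence[of _ _ "\<lambda>_. 0"] sat_pr_free[of _ P "\<lambda>_. 0"])

lemma coherentD:
  assumes "coherent T" "sentence \<phi>"
  shows "\<^bold>\<not> \<phi> \<in> T \<longleftrightarrow> \<phi> \<notin> T"
    and "sentence \<psi> \<Longrightarrow> \<phi> \<^bold>\<and> \<psi> \<in> T \<longleftrightarrow> \<phi> \<in> T \<and> \<psi> \<in> T"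
    and "sentence \<psi> \<Longrightarrow> \<phi> \<^bold>\<or> \<psi> \<in> T \<longleftrightarrow> \<phi> \<in> T \<or> \<psi> \<in> T"
    and "pr_free \<phi> \<Longrightarrow> \<phi> \<in> T \<longleftrightarrow> true_in P \<phi>"
  using assms unfolding coherent_def by blast+

lemma prob_connectives:
  "sentence \<phi> \<Longrightarrow> prob T (of_nat (prod_encode (11, code \<phi>))) y \<longleftrightarrow> y = of_bool (\<^bold>\<not> \<phi> \<in> T)"
  "sentence \<phi> \<Longrightarrow> sentence \<psi> \<Longrightarrow>
    prob T (of_nat (prod_encode (12, prod_encode (code \<phi>, code \<psi>)))) y \<longleftrightarrow>
    y = of_bool (\<phi> \<^bold>\<and> \<psi> \<in> T)"
  "sentence \<phi> \<Longrightarrow> sentence \<psi> \<Longrightarrow>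
    prob T (of_nat (prod_encode (13, prod_encode (code \<phi>, code \<psi>)))) y \<longleftrightarrow>
    y = of_bool (\<phi> \<^bold>\<or> \<psi> \<in> T)"
  using prob_code[of "\<^bold>\<not> \<phi>"] prob_code[of "\<phi> \<^bold>\<and> \<psi>"] prob_code[of "\<phi> \<^bold>\<or> \<psi>"] by auto

lemma sat_All_Imp_Ex: "sat P e (\<^bold>\<forall> (\<phi> \<^bold>\<longrightarrow> \<^bold>\<exists> \<psi>)) \<longleftrightarrow>
    (\<forall>a. sat P (case_nat a e) \<phi> \<longrightarrow> (\<exists>w. sat P (case_nat w (case_nat a e)) \<psi>))"
  by auto

lemma coherent_pr_axioms:
  assumes "coherent T" "\<phi> \<in> pr_axioms"
  shows "true_in (prob T) \<phi>"
  using assms(2)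
proof cases
  case (pr_reflect \<psi>)
  have "\<exists>w. sat (prob T) (case_nat w (case_nat a e))
      (Val (Var 1) (Var 0) \<^bold>\<and> (Pr (sub_code 0 (Var 1) \<psi>) \<^bold>1 \<^bold>\<longleftrightarrow> \<psi>))"
    if const: "sat (prob T) (case_nat a e) (ConstTerm (Var 0))" for a e
  proof -
    obtain t where t: "tm_below 0 t" "a = of_nat (code_tm t)" using const by auto
    \<comment> \<open>The value of the closed term is taken in the zero environment because
      \<open>?e\<close> is itself built from that value.\<close>
    let ?e = "case_nat (eval (\<lambda>_. 0) t) (case_nat a e)"
    have val: "eval ?e t = eval (\<lambda>_. 0) t" using t(1) by (rule eval_below_cong) simp
    have "sat (prob T) ?e (Val (Var 1) (Var 0))"
      by (rule sat_Val[OF t(1)]) (use val t(2) in simp_all)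
    moreover have "eval ?e (sub_code 0 (Var 1) \<psi>) = of_nat (code (inst \<psi> t))"
      by (rule eval_sub_code_inst[OF _ t(1) pr_reflect(3)]) (simp add: t(2))
    moreover have sentence: "sentence (inst \<psi> t)"
      unfolding inst_def using pr_reflect(3) by (rule fm_below_subst) (use t(1) in simp)
    moreover have "inst \<psi> t \<in> T \<longleftrightarrow> sat (prob T) ?e \<psi>"
    proof -
      \<comment> \<open>The instance is \<open>Pr\<close>-free, so coherence ties its membership to
        truth under any reading of \<open>Pr\<close>, in particular the one by \<open>T\<close>
        itself.\<close>
      have "inst \<psi> t \<in> T \<longleftrightarrow> true_in (prob T) (inst \<psi> t)"
        using assms(1) sentence pr_reflect(2) by (simp add: coherent_def inst_def)
      also have "\<dots> \<longleftrightarrow> sat (prob T) (case_nat (eval (\<lambda>_. 0) t) (\<lambda>_. 0)) \<psi>"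
        using true_in_sentence[OF sentence, of _ "\<lambda>_. 0"] by (simp add: sat_inst)
      also have "\<dots> \<longleftrightarrow> sat (prob T) ?e \<psi>"
        using pr_reflect(3) by (rule sat_below_cong) simp
      finally show ?thesis .
    qed
    ultimately show ?thesis by (intro exI[of _ "eval (\<lambda>_. 0) t"]) simp
  qed
  then show ?thesis unfolding pr_reflect(1) true_in_def sat_All_Imp_Ex by blast
next
  case pr_total
  show ?thesis unfolding pr_total true_in_def by auto
next
  case pr_unique
  show ?thesis unfolding pr_unique true_in_def by (auto simp: prob_def)
next
  case pr_range
  show ?thesis unfolding pr_range true_in_def by (auto simp: prob_def)
next
  case pr_dis_left
  show ?thesis unfolding pr_dis_left true_in_def
    by (auto simp: prob_connectives coherentD(1-3)[OF assms(1)])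
next
  case pr_dis_right
  show ?thesis unfolding pr_dis_right true_in_def
    by (auto simp: prob_connectives coherentD(1-3)[OF assms(1)])
next
  case pr_additive
  show ?thesis unfolding pr_additive true_in_def
    by (auto simp: prob_connectives coherentD(1-3)[OF assms(1)])
next
  case pr_neg
  show ?thesis unfolding pr_neg true_in_def
    by (auto simp: prob_connectives coherentD(1-3)[OF assms(1)])
qed

section \<open>Soundness\<close>

lemma prop_eval_sat: "prop_eval (sat P e) \<phi> \<longleftrightarrow> sat P e \<phi>"
  by (induction \<phi>) simp_all

lemma true_in_logical_axioms: "\<phi> \<in> logical_axioms \<Longrightarrow> true_in P \<phi>"
proof (induction rule: logical_axioms.induct)
  case (taut \<phi>)
  then show ?case using prop_eval_sat unfolding true_in_def by blast
qed (auto simp: true_in_def sat_inst sat_lift)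

text \<open>\<open>N\<close> denotes the standard natural numbers, so induction on type
  \<open>nat\<close> applies to every formula, however \<open>Pr\<close> is interpreted.\<close>

lemma true_in_induction: "true_in P (induction \<phi>)"
  unfolding true_in_def
proof
  fix e
  have "sat P e (\<^bold>\<forall>\<^sub>N \<phi>)"
    if zero: "sat P e (inst \<phi> \<^bold>0)"
      and step: "sat P e (\<^bold>\<forall>\<^sub>N (\<phi> \<^bold>\<longrightarrow> subst (case_nat (Var 0 \<^bold>+ \<^bold>1) (\<lambda>i. Var (Suc i))) \<phi>))"
    unfolding sat_AllN
  proof
    fix n :: nat
    show "sat P (case_nat (of_nat n) e) \<phi>"
    proof (induction n)
      case 0
      then show ?case using zero unfolding sat_inst eval.simps of_nat_0 by assumption
    next
      case (Suc n)
      have env: "(\<lambda>i. eval (case_nat (of_nat n) e) (case_nat (Var 0 \<^bold>+ \<^bold>1) (\<lambda>i. Var (Suc i)) i)) =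
          case_nat (of_nat (Suc n)) e"
        by (auto simp: fun_eq_iff split: nat.splits)
      have "sat P (case_nat (of_nat n) e)
          (\<phi> \<^bold>\<longrightarrow> subst (case_nat (Var 0 \<^bold>+ \<^bold>1) (\<lambda>i. Var (Suc i))) \<phi>)"
        using step unfolding sat_AllN by (rule spec)
      then show ?case using Suc unfolding sat.simps sat_subst env by blast
    qed
  qed
  then show "sat P e (induction \<phi>)"
    unfolding induction_def by (simp del: sat.simps(8))
qed

lemma true_in_Q:
  assumes "standard_rational_theory A" "\<phi> \<in> Q A"
  shows "true_in P \<phi>"
  using assms true_in_induction unfolding standard_rational_theory_def Q_def Q_minus_def by blast

lemma true_in_nec: "sentence \<phi> \<Longrightarrow> true_in (prob T) (Pr (num (code \<phi>)) \<^bold>1) \<longleftrightarrow> \<phi> \<in> T"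
  by (simp add: true_in_def)

text \<open>The necessitation case rests on \<open>T\<close> containing the theorems, not on the
  truth of the premise in \<open>prob T\<close>. The lemma therefore applies to sets that differ
  from the truth set of their own model.\<close>

lemma RKf_true_in_prob:
  assumes "standard_rational_theory A" "coherent T"
    and nec: "\<And>\<phi>. RKf (Q A) \<phi> \<Longrightarrow> sentence \<phi> \<Longrightarrow> \<phi> \<in> T"
  shows "RKf (Q A) \<phi> \<Longrightarrow> true_in (prob T) \<phi>"
proof (induction rule: RKf.induct)
  case (logic \<phi>)
  then show ?case by (rule true_in_logical_axioms)
next
  case (base \<phi>)
  then show ?case by (rule true_in_Q[OF assms(1)])
next
  case (prob \<phi>)
  then show ?case by (rule coherent_pr_axioms[OF assms(2)])
next
  case (mp \<phi> \<psi>)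
  then show ?case by (simp add: true_in_def)
next
  case (gen \<phi>)
  then show ?case by (simp add: true_in_def)
next
  case (nec \<phi>)
  then show ?case using assms(3) by (simp add: true_in_nec)
qed

section \<open>The revision sequence\<close>

primrec revision :: "nat \<Rightarrow> fm set" where
  "revision 0 = {\<phi>. true_in (\<lambda>_ _. False) \<phi>}"
| "revision (Suc n) = {\<phi>. true_in (prob (revision n)) \<phi>}"

lemma coherent_revision: "coherent (revision n)"
  by (cases n) (simp_all add: coherent_truth)

text \<open>The eventuality quantifier absorbs the count of nested necessitations. Modus ponens
  intersects two tails; necessitation moves a tail up by one, because
  \<open>prob (revision (Suc n))\<close> records what is true in
  \<open>prob (revision n)\<close>.\<close>

lemma RKf_eventually_true:
  assumes "standard_rational_theory A"
  shows "RKf (Q A) \<phi> \<Longrightarrow> \<forall>\<^sub>F n in sequentially. true_in (prob (revision n)) \<phi>"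
proof (induction rule: RKf.induct)
  case (logic \<phi>)
  then show ?case by (simp add: true_in_logical_axioms)
next
  case (base \<phi>)
  then show ?case by (simp add: true_in_Q[OF assms])
next
  case (prob \<phi>)
  then show ?case by (simp add: coherent_pr_axioms coherent_revision)
next
  case (mp \<phi> \<psi>)
  from mp.IH show ?case by eventually_elim (simp add: true_in_def)
next
  case (gen \<phi>)
  from gen.IH show ?case by eventually_elim (simp add: true_in_def)
next
  case (nec \<phi>)
  then have "\<forall>\<^sub>F n in sequentially. true_in (prob (revision (Suc n))) (Pr (num (code \<phi>)) \<^bold>1)"
    by (simp add: true_in_nec)
  then show ?case by (simp only: eventually_sequentially_Suc[of "\<lambda>n. true_in (prob (revision n)) _"])
qed

lemma RKf_eventually_in_revision:
  assumes "standard_rational_theory A" "RKf (Q A) \<phi>"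
  shows "\<forall>\<^sub>F n in sequentially. \<phi> \<in> revision n"
  using RKf_eventually_true[OF assms] eventually_sequentially_Suc[of "\<lambda>n. \<phi> \<in> revision n"] by simp


section \<open>The limit of the revision sequence\<close>

text \<open>Along any sequence a property holds infinitely often or fails infinitely often, so it is
  constant on a subsequence, and constancy is inherited by further subsequences. A diagonal sequence
  then handles countably many properties at once.\<close>

lemma ex_deciding_subseq:
  fixes R :: "nat \<Rightarrow> nat \<Rightarrow> bool"
  shows "\<exists>r. strict_mono r \<and>
    (\<forall>i. (\<forall>\<^sub>F n in sequentially. R i (r n)) \<or> (\<forall>\<^sub>F n in sequentially. \<not> R i (r n)))"
proof -
  let ?D = "\<lambda>i s. (\<forall>n. R i (s n)) \<or> (\<forall>n. \<not> R i (s n))"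
  interpret subseqs ?D
  proof
    fix i and s :: "nat \<Rightarrow> nat"
    have "{n. R i (s n)} \<union> {n. \<not> R i (s n)} = UNIV" by blast
    then have "infinite {n. R i (s n)} \<or> infinite {n. \<not> R i (s n)}"
      by (metis finite_Un infinite_UNIV_nat)
    then obtain r :: "nat \<Rightarrow> nat" where r: "strict_mono r"
      "(\<forall>n. r n \<in> {n. R i (s n)}) \<or> (\<forall>n. r n \<in> {n. \<not> R i (s n)})"
      using infinite_enumerate by meson
    show "\<exists>r :: nat \<Rightarrow> nat. strict_mono r \<and> ?D i (s \<circ> r)"
      by (rule exI[of _ r]) (use r in simp)
  qed
  have "(\<forall>\<^sub>F n in sequentially. R i (diagseq n)) \<or> (\<forall>\<^sub>F n in sequentially. \<not> R i (diagseq n))" for i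
  proof -
    \<comment> \<open>Only the tail after the first \<open>Suc i\<close> entries is sure to be
      constant for property \<open>i\<close>, hence the eventuality in the statement.\<close>
    have "?D i (diagseq \<circ> (+) (Suc i))" by (rule diagseq_holds) auto
    then have "(\<forall>\<^sub>F n in sequentially. R i (diagseq (n + Suc i))) \<or>
        (\<forall>\<^sub>F n in sequentially. \<not> R i (diagseq (n + Suc i)))"
      unfolding comp_apply add.commute[of "Suc i"] by (auto intro: always_eventually)
    then show ?thesis
      unfolding eventually_sequentially_seg[of "\<lambda>n. R i (diagseq n)"]
        eventually_sequentially_seg[of "\<lambda>n. \<not> R i (diagseq n)"] .
  qed
  with subseq_diagseq show ?thesis by blast
qed

text \<open>Eventual membership always commutes with conjunction; decidedness adds negation and
  thereby disjunction. On the sets \<open>{n. \<phi> \<in> T n}\<close> the filter of tails acts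
  like an ultrafilter. Membership of a \<open>Pr\<close>-free sentence does not depend on
  \<open>n\<close>.\<close>

lemma coherent_limit:
  assumes T: "\<And>n. coherent (T n)"
    and decided: "\<And>\<phi>. (\<forall>\<^sub>F n in sequentially. \<phi> \<in> T n) \<or> (\<forall>\<^sub>F n in sequentially. \<phi> \<notin> T n)"
  shows "coherent {\<phi>. \<forall>\<^sub>F n in sequentially. \<phi> \<in> T n}"
proof -
  have not: "(\<forall>\<^sub>F n in sequentially. \<phi> \<notin> T n) \<longleftrightarrow> \<not> (\<forall>\<^sub>F n in sequentially. \<phi> \<in> T n)" for \<phi>
  proof -
    have "\<not> ((\<forall>\<^sub>F n in sequentially. \<phi> \<in> T n) \<and> (\<forall>\<^sub>F n in sequentially. \<phi> \<notin> T n))"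
      unfolding eventually_conj_iff[symmetric] by simp
    with decided show ?thesis by blast
  qed
  have or: "(\<forall>\<^sub>F n in sequentially. \<phi> \<in> T n \<or> \<psi> \<in> T n) \<longleftrightarrow>
      (\<forall>\<^sub>F n in sequentially. \<phi> \<in> T n) \<or> (\<forall>\<^sub>F n in sequentially. \<psi> \<in> T n)" for \<phi> \<psi>
  proof
    assume *: "\<forall>\<^sub>F n in sequentially. \<phi> \<in> T n \<or> \<psi> \<in> T n"
    have "\<forall>\<^sub>F n in sequentially. \<psi> \<in> T n" if "\<forall>\<^sub>F n in sequentially. \<phi> \<notin> T n"
      using * that by eventually_elim blast
    then show "(\<forall>\<^sub>F n in sequentially. \<phi> \<in> T n) \<or> (\<forall>\<^sub>F n in sequentially. \<psi> \<in> T n)"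
      using not by blast
  qed (auto elim: eventually_mono)
  have "(\<forall>\<^sub>F n in sequentially. \<phi> \<in> T n) \<longleftrightarrow> true_in P \<phi>" if "sentence \<phi>" "pr_free \<phi>" for \<phi> P
    by (simp add: coherentD(4)[OF T that, where P = P])
  then show ?thesis
    unfolding coherent_def by (simp add: coherentD(1-3)[OF T] not or eventually_conj_iff)
qed

section \<open>The standard model and its consequence\<close>

lemma ex_model:
  assumes "standard_rational_theory A"
  shows "\<exists>P. \<forall>\<phi>. RKf (Q A) \<phi> \<longrightarrow> true_in P \<phi>"
proof -
  \<comment> \<open>\<open>inv code\<close> turns the numbered properties of the diagonal argument
    into formulas; a number that is no code merely yields an arbitrary formula.\<close>
  obtain r where r: "strict_mono r" and
    dec: "\<And>i. (\<forall>\<^sub>F n in sequentially. inv code i \<in> revision (r n)) \<or>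
      (\<forall>\<^sub>F n in sequentially. inv code i \<notin> revision (r n))"
    using ex_deciding_subseq[of "\<lambda>i n. inv code i \<in> revision n"] by blast
  have inv: "inv code (code \<phi>) = \<phi>" for \<phi> by (rule inv_f_f) (simp add: inj_def)
  have dec': "(\<forall>\<^sub>F n in sequentially. \<phi> \<in> revision (r n)) \<or>
      (\<forall>\<^sub>F n in sequentially. \<phi> \<notin> revision (r n))" for \<phi>
    using dec[of "code \<phi>"] unfolding inv .
  let ?T = "{\<phi>. \<forall>\<^sub>F n in sequentially. \<phi> \<in> revision (r n)}"
  have "coherent ?T" by (rule coherent_limit[OF coherent_revision dec'])
  moreover have "\<phi> \<in> ?T" if "RKf (Q A) \<phi>" for \<phi>
    using eventually_subseq[OF r RKf_eventually_in_revision[OF assms that]] by simp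
  ultimately have "\<forall>\<phi>. RKf (Q A) \<phi> \<longrightarrow> true_in (prob ?T) \<phi>"
    using RKf_true_in_prob[OF assms] by blast
  then show ?thesis by (rule exI[of _ "prob ?T"])
qed

text \<open>Since \<open>N\<close> is standard, a witness for the existential statement is the value
  of a numeral, and the instance for that numeral is true in the model.\<close>

lemma omega_consistent_if_model:
  assumes "\<And>\<phi>. T \<phi> \<Longrightarrow> true_in P \<phi>"
  shows "omega_consistent T"
  unfolding omega_consistent_def
proof (intro notI, elim exE conjE)
  fix \<phi>
  assume inst: "\<forall>n. T (inst \<phi> (num n))" and ex: "T (\<^bold>\<exists>\<^sub>N (\<^bold>\<not> \<phi>))"
  have "sat P (case_nat (of_nat n) (\<lambda>_. 0)) \<phi>" for n
    using assms inst unfolding true_in_def by (metis sat_inst eval_num)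
  moreover have "sat P (\<lambda>_. 0) (\<^bold>\<exists>\<^sub>N (\<^bold>\<not> \<phi>))"
    using assms ex unfolding true_in_def by blast
  ultimately show False unfolding sat_ExN by simp
qed

theorem corollary2:
  fixes A :: "fm set"
  assumes "standard_rational_theory A"
  shows "(\<exists>P. \<forall>\<phi>. RKf (Q A) \<phi> \<longrightarrow> true_in P \<phi>) \<and> omega_consistent (RKf (Q A))"
  using ex_model[OF assms] omega_consistent_if_model by blast

end
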